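(* Let $m\ge 2$ be an integer, $\alpha=m-2$, $\theta\ge 0$, $\beta=\theta/(1+\theta)$, and let $\mathbf v\in\mathbb R^2$ be a non-random vector with $\|\mathbf v\|=1$. Let $\mathbf W\sim\mathcal W_2(m,\mathbf I_2+\theta\,\mathbf v\mathbf v^T)$ be a real Wishart matrix and let $\mathbf o_1,\mathbf o_2$ be real unit eigenvectors corresponding to the smallest and the largest eigenvalue of $\mathbf W$, respectively. Then the p.d.f. of $W_1^{(2)}=|\mathbf v^T\mathbf o_1|^2$ is, for $z\in(0,1)$, $$f^{(\alpha)}_{W_1^{(2)}}(z)=\frac{2^{m-1}(m-1)}{\pi(1+\theta)^{m/2}}\,z^{-\frac12}(1-z)^{-\frac12}\,[1-\beta(1-z)]^{-m}\Bigg[\frac1{m-1}\,{}_2F_1\!\left(m,\frac{m-1}2;\frac{m+1}2;-\frac{1-\beta z}{1-\beta(1-z)}\right)-\frac1{m+1}\,{}_2F_1\!\left(m,\frac{m+1}2;\frac{m+3}2;-\frac{1-\beta z}{1-\beta(1-z)}\right)\Bigg],$$ and the p.d.f. of $W_2^{(2)}=|\mathbf v^T\mathbf o_2|^2$ is $f^{(\alpha)}_{W_2^{(2)}}(z)=f^{(\alpha)}_{W_1^{(2)}}(1-z)$.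
   Context: $\mathcal W_n(m,\boldsymbol\Sigma)$ with $m\ge n$ denotes the real Wishart distribution: the law of $\mathbf X\mathbf X^T$ where $\mathbf X\in\mathbb R^{n\times m}$ has i.i.d. columns distributed as the real Gaussian $\mathcal N_n(\mathbf 0,\boldsymbol\Sigma)$. The eigenvalues are almost surely distinct. ${}_2F_1$ is the Gauss hypergeometric function (analytically continued to $(-\infty,0]$ via its Euler integral). *)

theory Defs
  imports "HOL-Probability.Probability"
begin

text \<open>Centred Gaussian with positive definite covariance matrix \<open>S\<close>.\<close>

definition gaussian_measure :: "real ^ 'n ^ 'n \<Rightarrow> (real ^ 'n) measure" where
  "gaussian_measure S = density lborel (\<lambda>x. ennreal
     (exp (- (x \<bullet> (matrix_inv S *v x)) / 2) / sqrt ((2 * pi) ^ CARD('n) * det S)))"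

text \<open>
  An \<open>n \<times> m\<close> matrix \<open>X\<close> is represented by the family of its columns \<open>X 0, \<dots>, X (m - 1)\<close>,
  so that the number of columns can be an ordinary natural number; \<open>gram m X\<close> is then
  the product of this matrix with its transpose.
\<close>

definition gram :: "nat \<Rightarrow> (nat \<Rightarrow> real ^ 'n) \<Rightarrow> real ^ 'n ^ 'n" where
  "gram m X = (\<chi> i k. \<Sum>j<m. X j $ i * X j $ k)"

definition wishart :: "nat \<Rightarrow> real ^ 'n ^ 'n \<Rightarrow> (real ^ 'n ^ 'n) measure" where
  "wishart m S = distr (\<Pi>\<^sub>M j\<in>{..<m}. gaussian_measure S) borel (gram m)"

definition eigenvalues :: "real ^ 'n ^ 'n \<Rightarrow> real set" where
  "eigenvalues A = {\<mu>. \<exists>x. x \<noteq> 0 \<and> A *v x = \<mu> *\<^sub>R x}"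

definition unit_eigenvector :: "real ^ 'n ^ 'n \<Rightarrow> real \<Rightarrow> real ^ 'n \<Rightarrow> bool" where
  "unit_eigenvector A \<mu> x \<longleftrightarrow> norm x = 1 \<and> A *v x = \<mu> *\<^sub>R x"

definition outer :: "real ^ 'n \<Rightarrow> real ^ 'n \<Rightarrow> real ^ 'n ^ 'n" where
  "outer u v = (\<chi> i k. u $ i * v $ k)"

text \<open>
  Gauss hypergeometric function of a real argument \<open>x < 1\<close>: the Gauss series inside the unit
  disc, and Euler's integral (meaningful for \<open>0 < b < c\<close>) for \<open>x \<le> - 1\<close>.
\<close>

definition hyp2F1 :: "real \<Rightarrow> real \<Rightarrow> real \<Rightarrow> real \<Rightarrow> real" where
  "hyp2F1 a b c x =
     (if \<bar>x\<bar> < 1 then eval_fps (fps_hypergeo [a, b] [c] 1) x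
      else Gamma c / (Gamma b * Gamma (c - b)) *
        (LBINT t:{0<..<1}. t powr (b - 1) * (1 - t) powr (c - b - 1) * (1 - x * t) powr (- a)))"

end

theory Submission
  imports Defs
begin

text \<open>
  Complete \<open>v\<close> to an orthonormal basis and write \<open>a, b, c\<close> for the entries of the Gram matrix in it.
  The law of \<open>(a, b, c)\<close> has the Wishart density, by induction on \<open>m\<close>: adding a column \<open>x\<close> convolves with
  the law of \<open>x x\<^sup>T\<close>; the exponential factors multiply up to the new one, and
  \<open>det (G - x x\<^sup>T) = det G - q(x)\<close> for a quadratic form \<open>q\<close> of determinant \<open>det G\<close>, so that the
  \<open>x\<close>-integral is radial after completing the square. For \<open>m = 2\<close> the entries \<open>b, c\<close> are obtained
  from the second row of the \<open>2 \<times> 2\<close> matrix by the linear coordinates \<open>b\<close> and \<open>det\<close>.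

  Almost surely \<open>b \<noteq> 0\<close>, and then \<open>(v \<bullet> o\<^sub>1)\<^sup>2 = (1 - s / sqrt (1 + s\<^sup>2)) / 2\<close> with
  \<open>a - c = 2 b s\<close>. Substituting \<open>a = c + 2 b s\<close>, \<open>c = b y\<close>, integrating out \<open>b\<close> as a Gamma integral and
  parametrising the remaining ray of \<open>y\<close> by the eigenvalue ratio \<open>t \<in> (0, 1)\<close> leaves the difference of
  two Euler integrals.
\<close>

section \<open>One-dimensional substitutions\<close>

text \<open>The induction starts at two columns because the Gram matrix of a single column is
  singular and has no density. Laws are compared by integrating an arbitrary nonnegative test
  function with values in \<open>ennreal\<close>, so that Tonelli and substitutions need no
  integrability. Apart from the rotation to a basis containing \<open>v\<close>, every change of
  variables is a chain of one-dimensional substitutions between exchanges of integrals, with slopes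
  in place of angles.

  The shape of the answer comes from the eigenvalues \<open>l1 < l2\<close>, with
  \<open>t = l1 / l2\<close>. Put \<open>A = 1 / (1 + \<theta>)\<close>. The inverse covariance
  takes the value \<open>C = 1 - \<beta> * z\<close> at the first eigenvector and
  \<open>B = 1 - \<beta> * (1 - z)\<close> at the second, so the exponent \<open>A * a + c\<close>
  is \<open>l2 * (B + C * t)\<close>. Integrating out the scale gives the power \<open>-m\<close> of
  \<open>B + C * t\<close>; the determinant gives \<open>t powr ((m - 3) / 2)\<close>, and the
  eigenvalue gap gives \<open>1 - t\<close>. Splitting \<open>1 - t\<close> produces the two Euler
  integrals, at the argument \<open>- C / B\<close>. This can lie inside or outside the unit disc,
  so both branches of \<open>hyp2F1\<close> occur.\<close>

lemma nn_integral_substitution_einterval: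
  fixes f :: "real \<Rightarrow> ennreal" and g g' :: "real \<Rightarrow> real" and l u :: ereal
  assumes f [measurable]: "f \<in> borel_measurable borel"
    and g [measurable]: "g \<in> borel_measurable borel"
    and g' [measurable]: "g' \<in> borel_measurable borel"
    and lu: "l < u"
    and deriv: "\<And>x. x \<in> einterval l u \<Longrightarrow> (g has_real_derivative g' x) (at x)"
    and cont: "continuous_on (einterval l u) g'"
    and nonneg: "\<And>x. x \<in> einterval l u \<Longrightarrow> 0 \<le> g' x"
  shows "(\<integral>\<^sup>+x. f x * indicator (g ` einterval l u) x \<partial>lborel)
       = (\<integral>\<^sup>+x. f (g x) * ennreal (g' x) * indicator (einterval l u) x \<partial>lborel)"
proof -
  \<comment> \<open>Later substitutions have derivatives that blow up at an end, or unbounded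
    images. The formula is therefore applied on compact intervals exhausting the domain; both sides
    are measures of increasing sets, so the limit is continuity from below.\<close>
  obtain b a :: "nat \<Rightarrow> real" where ab: "einterval l u = (\<Union>i. {a i .. b i})"
    "incseq b" "decseq a" "\<And>i. a i < b i"
    by (rule einterval_Icc_approximation[OF lu]) blast
  have sub: "{a i..b i} \<subseteq> einterval l u" for i
    using ab(1) by blast
  have mono: "g x \<le> g y" if "x \<in> {a i..b i}" "y \<in> {a i..b i}" "x \<le> y" for x y i
  proof (rule DERIV_nonneg_imp_nondecreasing[OF that(3)])
    fix t assume "x \<le> t" "t \<le> y"
    then have "t \<in> einterval l u"
      using that sub[of i] by auto
    then show "\<exists>d. (g has_real_derivative d) (at t) \<and> 0 \<le> d"
      using deriv nonneg by blast
  qed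
  have img: "g ` {a i..b i} = {g (a i)..g (b i)}" for i
  proof
    show "g ` {a i..b i} \<subseteq> {g (a i)..g (b i)}"
    proof (rule image_subsetI)
      fix x assume "x \<in> {a i..b i}"
      with ab(4)[of i] show "g x \<in> {g (a i)..g (b i)}"
        unfolding atLeastAtMost_iff
        by (intro conjI mono[where i = i]) (simp_all only: atLeastAtMost_iff less_imp_le order_refl)
    qed
    have "continuous_on {a i..b i} g"
      by (rule DERIV_continuous_on[OF has_field_derivative_at_within[OF deriv]]) (use sub[of i] in blast)
    then have "\<exists>x. a i \<le> x \<and> x \<le> b i \<and> g x = y" if "y \<in> {g (a i)..g (b i)}" for y
      using that by (intro IVT' less_imp_le[OF ab(4)]) auto
    then show "{g (a i)..g (b i)} \<subseteq> g ` {a i..b i}"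
      by fastforce
  qed
  have incA: "incseq (\<lambda>i. {a i..b i})"
    using ab(2,3) unfolding incseq_def decseq_def atLeastatMost_subset_iff by blast
  then have incB: "incseq (\<lambda>i. {g (a i)..g (b i)})"
    unfolding incseq_def by (metis image_mono img)
  let ?M = "density lborel f"
  let ?N = "density lborel (\<lambda>x. f (g x) * ennreal (g' x))"
  have eq: "emeasure ?M {g (a i)..g (b i)} = emeasure ?N {a i..b i}" for i
  proof -
    have "x \<in> einterval l u" if "x \<in> {a i..b i}" for x
      using that sub[of i] by blast
    then show ?thesis
      using nn_integral_substitution_aux[of f "a i" "b i" g g', OF f _ deriv
          continuous_on_subset[OF cont sub] nonneg ab(4)]
      by (simp add: emeasure_density)
  qed
  have imgS: "g ` einterval l u \<in> sets borel"
    unfolding ab(1) image_UN img by auto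
  have "emeasure ?M (g ` einterval l u) = (SUP i. emeasure ?M {g (a i)..g (b i)})"
    unfolding ab(1) image_UN img by (rule SUP_emeasure_incseq[symmetric]) (use incB in auto)
  also have "\<dots> = emeasure ?N (einterval l u)"
    unfolding ab(1) eq by (rule SUP_emeasure_incseq) (use incA in auto)
  finally show ?thesis
    by (simp add: emeasure_density imgS)
qed

lemma nn_integral_even:
  fixes f :: "real \<Rightarrow> ennreal"
  assumes [measurable]: "f \<in> borel_measurable borel" and ev: "\<And>x. f (- x) = f x"
  shows "(\<integral>\<^sup>+x. f x \<partial>lborel) = 2 * (\<integral>\<^sup>+x\<in>{0<..}. f x \<partial>lborel)"
proof -
  have "(\<integral>\<^sup>+x. f x \<partial>lborel) = (\<integral>\<^sup>+x. (f x * indicator {0<..} x + f x * indicator {..<0} x) \<partial>lborel)"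
    by (intro nn_integral_cong_AE, use AE_lborel_singleton[of 0] in eventually_elim)
       (auto split: split_indicator)
  also have "\<dots> = (\<integral>\<^sup>+x\<in>{0<..}. f x \<partial>lborel) + (\<integral>\<^sup>+x\<in>{..<0}. f x \<partial>lborel)"
    by (rule nn_integral_add) auto
  also have "(\<integral>\<^sup>+x\<in>{..<0}. f x \<partial>lborel) = (\<integral>\<^sup>+x\<in>{0<..}. f x \<partial>lborel)"
    by (subst nn_integral_real_affine[where c = "-1" and t = 0])
       (auto simp: ev intro!: nn_integral_cong split: split_indicator)
  finally show ?thesis by (simp add: mult_2)
qed

lemma nn_integral_inverse_1_plus_square:
  "(\<integral>\<^sup>+x. ennreal (1 / (1 + x\<^sup>2)) \<partial>lborel) = ennreal pi"
proof -
  have "integrable lborel (\<lambda>x::real. inverse (1 + x\<^sup>2))"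
    using integrable_inverse_1_plus_square by (simp add: set_integrable_def)
  moreover have "(LINT x|lborel. inverse (1 + x\<^sup>2)) = pi"
    using LBINT_inverse_1_plus_square by (simp add: interval_lebesgue_integral_def set_lebesgue_integral_def)
  ultimately show ?thesis
    by (subst nn_integral_eq_integral) (auto simp: inverse_eq_divide)
qed

text \<open>Under \<open>a = p^2 * k\<close> the two half-lines have the same image, and their two
  copies cancel the 2 in the derivative \<open>2 * p * k\<close>. The weight
  \<open>\<bar>p\<bar>\<close> is the Jacobian left by a preceding change to a slope, or is inserted
  by hand.\<close>

lemma nn_integral_square_scaled:
  fixes F :: "real \<Rightarrow> ennreal"
  assumes [measurable]: "F \<in> borel_measurable borel" and k: "0 < k"
  shows "(\<integral>\<^sup>+p. F (p\<^sup>2 * k) * ennreal \<bar>p\<bar> \<partial>lborel)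
       = ennreal (1 / k) * (\<integral>\<^sup>+a\<in>{0<..}. F a \<partial>lborel)"
proof -
  have img: "(\<lambda>p. p\<^sup>2 * k) ` {0<..} = {0<..}"
  proof (intro equalityI subsetI)
    fix a :: real assume "a \<in> {0<..}"
    then show "a \<in> (\<lambda>p. p\<^sup>2 * k) ` {0<..}"
      using k by (intro image_eqI[of _ _ "sqrt (a / k)"]) auto
  qed (use k in auto)
  have ei: "einterval 0 \<infinity> = {0<..}" by (auto simp: einterval_def zero_ereal_def)
  have "(\<integral>\<^sup>+a. F a * indicator ((\<lambda>p. p\<^sup>2 * k) ` einterval 0 \<infinity>) a \<partial>lborel)
     = (\<integral>\<^sup>+p. F (p\<^sup>2 * k) * ennreal (2 * p * k) * indicator (einterval 0 \<infinity>) p \<partial>lborel)"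
    by (rule nn_integral_substitution_einterval)
       (use k in \<open>auto intro!: derivative_eq_intros continuous_intros simp: ei\<close>)
  then have "(\<integral>\<^sup>+a\<in>{0<..}. F a \<partial>lborel) =
     (\<integral>\<^sup>+p. F (p\<^sup>2 * k) * ennreal (2 * p * k) * indicator {0<..} p \<partial>lborel)"
    by (simp only: ei img)
  also have "\<dots> = (\<integral>\<^sup>+p. ennreal k * (2 * (F (p\<^sup>2 * k) * ennreal \<bar>p\<bar> * indicator {0<..} p)) \<partial>lborel)"
    using k by (intro nn_integral_cong) (auto simp: ennreal_mult' mult_ac split: split_indicator)
  also have "\<dots> = ennreal k * (2 * (\<integral>\<^sup>+p\<in>{0<..}. F (p\<^sup>2 * k) * ennreal \<bar>p\<bar> \<partial>lborel))"
  proof -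
    have [measurable]: "(\<lambda>p. F (p\<^sup>2 * k) * ennreal \<bar>p\<bar> * indicator {0<..} p) \<in> borel_measurable lborel"
      by measurable
    show ?thesis by (subst nn_integral_cmult, measurable, subst nn_integral_cmult) auto
  qed
  also have "\<dots> = ennreal k * (\<integral>\<^sup>+p. F (p\<^sup>2 * k) * ennreal \<bar>p\<bar> \<partial>lborel)"
    by (subst nn_integral_even) auto
  finally show ?thesis
    using k by (simp add: mult.assoc[symmetric] ennreal_mult'[symmetric])
qed

text \<open>The slope \<open>s = q / p\<close> plays the role of the angle: the area element becomes
  \<open>\<bar>p\<bar>\<close> in \<open>p\<close> and \<open>s\<close>, the squared radius is
  \<open>p^2 * (1 + s^2)\<close>, and \<pi> is the integral of the Cauchy weight
  \<open>1 / (1 + s^2)\<close>.\<close>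

lemma nn_integral_polar_radial:
  fixes F :: "real \<Rightarrow> ennreal"
  assumes [measurable]: "F \<in> borel_measurable borel"
  shows "(\<integral>\<^sup>+p. \<integral>\<^sup>+q. F (p\<^sup>2 + q\<^sup>2) \<partial>lborel \<partial>lborel) = ennreal pi * (\<integral>\<^sup>+a\<in>{0<..}. F a \<partial>lborel)"
proof -
  have "(\<integral>\<^sup>+p. \<integral>\<^sup>+q. F (p\<^sup>2 + q\<^sup>2) \<partial>lborel \<partial>lborel)
      = (\<integral>\<^sup>+p. \<integral>\<^sup>+s. F (p\<^sup>2 * (1 + s\<^sup>2)) * ennreal \<bar>p\<bar> \<partial>lborel \<partial>lborel)"
  proof (intro nn_integral_cong_AE, use AE_lborel_singleton[of 0] in eventually_elim)
    fix p :: real assume "p \<noteq> 0"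
    then show "(\<integral>\<^sup>+q. F (p\<^sup>2 + q\<^sup>2) \<partial>lborel) = (\<integral>\<^sup>+s. F (p\<^sup>2 * (1 + s\<^sup>2)) * ennreal \<bar>p\<bar> \<partial>lborel)"
      by (subst nn_integral_real_affine[where c = p and t = 0])
         (auto simp: nn_integral_multc mult.commute[of "ennreal _"] power_mult_distrib distrib_left)
  qed
  also have "\<dots> = (\<integral>\<^sup>+s. \<integral>\<^sup>+p. F (p\<^sup>2 * (1 + s\<^sup>2)) * ennreal \<bar>p\<bar> \<partial>lborel \<partial>lborel)"
    by (rule lborel_pair.Fubini') measurable
  also have "\<dots> = (\<integral>\<^sup>+s. ennreal (1 / (1 + s\<^sup>2)) * (\<integral>\<^sup>+a\<in>{0<..}. F a \<partial>lborel) \<partial>lborel)"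
    by (intro nn_integral_cong nn_integral_square_scaled) (auto intro: add_pos_nonneg)
  also have "\<dots> = ennreal pi * (\<integral>\<^sup>+a\<in>{0<..}. F a \<partial>lborel)"
    by (subst nn_integral_multc) (simp_all add: nn_integral_inverse_1_plus_square)
  finally show ?thesis .
qed

section \<open>The induction step for the Wishart density\<close>

text \<open>The form is that of the adjugate of the matrix with entries \<open>a, b, c\<close>, and
  this is the form subtracted from the determinant when a rank-one term is removed. Completing the
  square in \<open>q\<close> costs \<open>1 / sqrt a\<close> and rescaling \<open>p\<close> costs
  \<open>sqrt (a / \<Delta>)\<close>; together they leave \<open>1 / sqrt \<Delta>\<close>.\<close>

lemma nn_integral_quadratic_form:
  fixes F :: "real \<Rightarrow> ennreal"
  assumes [measurable]: "F \<in> borel_measurable borel" and a: "0 < a" and D: "b\<^sup>2 < a * c"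
  shows "(\<integral>\<^sup>+p. \<integral>\<^sup>+q. F (c * p\<^sup>2 - 2 * b * p * q + a * q\<^sup>2) \<partial>lborel \<partial>lborel)
       = ennreal (pi / sqrt (a * c - b\<^sup>2)) * (\<integral>\<^sup>+x\<in>{0<..}. F x \<partial>lborel)"
proof -
  define \<Delta> where "\<Delta> = a * c - b\<^sup>2"
  have \<Delta>: "0 < \<Delta>" using D by (simp add: \<Delta>_def)
  have sq: "c * p\<^sup>2 - 2 * b * p * (b * p / a + (1 / sqrt a) * y) + a * (b * p / a + (1 / sqrt a) * y)\<^sup>2
      = \<Delta> / a * p\<^sup>2 + y\<^sup>2" for p y
  proof -
    define k where "k = sqrt a"
    have "a = k\<^sup>2" "k > 0" using a by (auto simp: k_def)
    then show ?thesis
      unfolding \<Delta>_def k_def[symmetric] by (simp add: field_simps power2_eq_square)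
  qed
  have "(\<integral>\<^sup>+p. \<integral>\<^sup>+q. F (c * p\<^sup>2 - 2 * b * p * q + a * q\<^sup>2) \<partial>lborel \<partial>lborel)
      = (\<integral>\<^sup>+p. ennreal (1 / sqrt a) * (\<integral>\<^sup>+y. F (\<Delta> / a * p\<^sup>2 + y\<^sup>2) \<partial>lborel) \<partial>lborel)"
  proof (intro nn_integral_cong)
    fix p
    show "(\<integral>\<^sup>+q. F (c * p\<^sup>2 - 2 * b * p * q + a * q\<^sup>2) \<partial>lborel)
        = ennreal (1 / sqrt a) * (\<integral>\<^sup>+y. F (\<Delta> / a * p\<^sup>2 + y\<^sup>2) \<partial>lborel)"
      using a by (subst nn_integral_real_affine[where c = "1 / sqrt a" and t = "b * p / a"]) (simp_all only: sq, auto)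
  qed
  also have "\<dots> = ennreal (1 / sqrt a) * (\<integral>\<^sup>+p. \<integral>\<^sup>+y. F (\<Delta> / a * p\<^sup>2 + y\<^sup>2) \<partial>lborel \<partial>lborel)"
    by (rule nn_integral_cmult) measurable
  also have "(\<integral>\<^sup>+p. \<integral>\<^sup>+y. F (\<Delta> / a * p\<^sup>2 + y\<^sup>2) \<partial>lborel \<partial>lborel)
      = ennreal (sqrt (a / \<Delta>)) * (\<integral>\<^sup>+p. \<integral>\<^sup>+y. F (p\<^sup>2 + y\<^sup>2) \<partial>lborel \<partial>lborel)"
    using a \<Delta>
    by (subst nn_integral_real_affine[where c = "sqrt (a / \<Delta>)" and t = 0])
       (simp_all add: power_mult_distrib)
  also have "(\<integral>\<^sup>+p. \<integral>\<^sup>+y. F (p\<^sup>2 + y\<^sup>2) \<partial>lborel \<partial>lborel) = ennreal pi * (\<integral>\<^sup>+x\<in>{0<..}. F x \<partial>lborel)"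
    by (rule nn_integral_polar_radial) fact
  finally have "(\<integral>\<^sup>+p. \<integral>\<^sup>+q. F (c * p\<^sup>2 - 2 * b * p * q + a * q\<^sup>2) \<partial>lborel \<partial>lborel)
    = ennreal (1 / sqrt a * (sqrt (a / \<Delta>) * pi)) * (\<integral>\<^sup>+x\<in>{0<..}. F x \<partial>lborel)"
    using a \<Delta> by (simp only: mult.assoc ennreal_mult'[of "1 / sqrt a"] ennreal_mult'[of "sqrt (a / \<Delta>)"]
        real_sqrt_ge_zero zero_le_divide_1_iff less_imp_le divide_nonneg_pos)
  also have "1 / sqrt a * (sqrt (a / \<Delta>) * pi) = pi / sqrt \<Delta>"
    using a \<Delta> by (simp add: real_sqrt_divide)
  finally show ?thesis by (simp add: \<Delta>_def)
qed

text \<open>The radial integral left over in the induction step. For two columns the exponent is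
  \<open>-1/2\<close> and the integrand is unbounded near \<open>D\<close>, hence the bound
  \<open>-1 < r\<close> instead of nonnegativity.\<close>

lemma nn_integral_truncated_powr:
  fixes D r :: real
  assumes D: "0 < D" and r: "-1 < r"
  shows "(\<integral>\<^sup>+x\<in>{0<..}. ennreal ((D - x) powr r * indicator {..<D} x) \<partial>lborel)
       = ennreal (D powr (r + 1) / (r + 1))"
proof -
  have "(\<integral>\<^sup>+x\<in>{0<..}. ennreal ((D - x) powr r * indicator {..<D} x) \<partial>lborel)
      = (\<integral>\<^sup>+x. ennreal (if x \<in> {0..D} then x powr r else 0) \<partial>lborel)"
    by (subst nn_integral_real_affine[where c = "-1" and t = D])
       (auto intro!: nn_integral_cong_AE eventually_mono[OF AE_lborel_singleton[of D]]
             split: split_indicator)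
  also have "\<dots> = ennreal (D powr (r + 1) / (r + 1))"
    using has_integral_powr_from_0[OF r, of D] D
    by (intro nn_integral_has_integral_lborel)
       (simp_all only: has_integral_restrict_UNIV, auto)
  finally show ?thesis .
qed

text \<open>The three independent entries of the rank-one matrix built from \<open>u\<close>.
  Symmetric matrices are kept as triples so that \<open>lborel\<close> on triples is their reference
  measure.\<close>

definition sq_map :: "real \<times> real \<Rightarrow> real \<times> real \<times> real" where
  "sq_map u = ((fst u)\<^sup>2, fst u * snd u, (snd u)\<^sup>2)"

definition gauss_density :: "real \<Rightarrow> real \<times> real \<Rightarrow> real" where
  "gauss_density A u = sqrt A / (2 * pi) * exp (- (A * (fst u)\<^sup>2 + (snd u)\<^sup>2) / 2)"

text \<open>
  Here \<open>A = 1 - \<beta>\<close> is the inverse variance along \<open>v\<close>. By Legendre's duplication formula the constant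
  \<open>4 pi (m - 2)!\<close> is the usual \<open>2\<^sup>m sqrt pi Gamma (m / 2) Gamma ((m - 1) / 2)\<close>.
\<close>

definition wishart_density :: "nat \<Rightarrow> real \<Rightarrow> real \<times> real \<times> real \<Rightarrow> real" where
  "wishart_density m A w = (case w of (a, b, c) \<Rightarrow>
     A powr (real m / 2) / (4 * pi * fact (m - 2)) * (a * c - b\<^sup>2) powr ((real m - 3) / 2)
     * exp (- (A * a + c) / 2) * (if 0 < a \<and> b\<^sup>2 < a * c then 1 else 0))"

lemma sq_map_measurable [measurable]: "sq_map \<in> borel_measurable borel"
  unfolding sq_map_def[abs_def] by (intro borel_measurable_continuous_onI continuous_intros)

lemma gauss_density_measurable [measurable]: "gauss_density A \<in> borel_measurable borel"
  unfolding gauss_density_def[abs_def] by (intro borel_measurable_continuous_onI continuous_intros) auto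

lemma wishart_density_measurable [measurable]: "wishart_density m A \<in> borel_measurable borel"
  unfolding wishart_density_def[abs_def] borel_prod[symmetric] by measurable

lemma gauss_density_nonneg: "0 < A \<Longrightarrow> 0 \<le> gauss_density A u"
  by (simp add: gauss_density_def)

text \<open>Positive definiteness is tested by the leading entry and the determinant. Multiplying
  the quadratic form by the leading entry, \<open>a - p^2\<close> in one direction and
  \<open>a\<close> in the other, makes it a determinant times \<open>p^2\<close> plus a square. Its
  purpose is to turn the support condition of the shifted density into a bound on the value of the
  quadratic form, so that the whole integrand depends on that value alone.\<close>

lemma posdef_minus_rank_one_iff:
  fixes a b c p q :: real
  shows "0 < a - p\<^sup>2 \<and> (b - p * q)\<^sup>2 < (a - p\<^sup>2) * (c - q\<^sup>2) \<longleftrightarrow>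
    0 < a \<and> b\<^sup>2 < a * c \<and> c * p\<^sup>2 - 2 * b * p * q + a * q\<^sup>2 < a * c - b\<^sup>2" (is "?L \<longleftrightarrow> ?R")
proof -
  have det: "(a - p\<^sup>2) * (c - q\<^sup>2) - (b - p * q)\<^sup>2 = a * c - b\<^sup>2 - (c * p\<^sup>2 - 2 * b * p * q + a * q\<^sup>2)"
    by algebra
  show ?thesis
  proof
    assume L: ?L
    then have a: "0 < a" using zero_le_power2[of p] by linarith
    have "(a - p\<^sup>2) * (c * p\<^sup>2 - 2 * b * p * q + a * q\<^sup>2)
       = p\<^sup>2 * ((a - p\<^sup>2) * (c - q\<^sup>2) - (b - p * q)\<^sup>2) + ((a - p\<^sup>2) * q - (b - p * q) * p)\<^sup>2"
      by algebra
    also have "\<dots> \<ge> 0"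
      using L by (intro add_nonneg_nonneg mult_nonneg_nonneg) auto
    finally have "0 \<le> c * p\<^sup>2 - 2 * b * p * q + a * q\<^sup>2"
      using L by (simp add: zero_le_mult_iff)
    with a L det show ?R by linarith
  next
    assume R: ?R
    have "a * (c * p\<^sup>2 - 2 * b * p * q + a * q\<^sup>2) = (a * c - b\<^sup>2) * p\<^sup>2 + (a * q - b * p)\<^sup>2"
      by algebra
    moreover have "a * (c * p\<^sup>2 - 2 * b * p * q + a * q\<^sup>2) < a * (a * c - b\<^sup>2)"
      using R by (intro mult_strict_left_mono) auto
    ultimately have "(a * c - b\<^sup>2) * p\<^sup>2 < a * (a * c - b\<^sup>2)"
      using zero_le_power2[of "a * q - b * p"] by linarith
    then have "(a * c - b\<^sup>2) * p\<^sup>2 < (a * c - b\<^sup>2) * a"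
      by (simp only: mult.commute)
    then have "p\<^sup>2 < a" using R by (simp add: mult_less_cancel_left)
    then show ?L using R det by linarith
  qed
qed

lemma wishart_density_step:
  assumes A: "0 < A" and m: "2 \<le> m"
  shows "(\<integral>\<^sup>+u. ennreal (wishart_density m A (w - sq_map u)) * ennreal (gauss_density A u) \<partial>lborel)
       = ennreal (wishart_density (Suc m) A w)"
proof -
  obtain a b c where w: "w = (a, b, c)" by (metis prod_cases3)
  define \<Delta> where "\<Delta> = a * c - b\<^sup>2"
  define r where "r = (real m - 3) / 2"
  define K where "K = A powr (real m / 2) / (4 * pi * fact (m - 2)) * (sqrt A / (2 * pi)) * exp (- (A * a + c) / 2)"
  define P where "P \<longleftrightarrow> 0 < a \<and> b\<^sup>2 < a * c"
  have K: "0 \<le> K" using A by (auto simp: K_def)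
  have r: "-1 < r" using m by (simp add: r_def)
  have [measurable]: "(\<lambda>x. ennreal ((\<Delta> - x) powr r * indicator {..<\<Delta>} x)) \<in> borel_measurable borel"
    by measurable
  have eq: "wishart_density m A (w - sq_map (p, q)) * gauss_density A (p, q)
     = K * of_bool P * ((\<Delta> - (c * p\<^sup>2 - 2 * b * p * q + a * q\<^sup>2)) powr r
           * indicator {..<\<Delta>} (c * p\<^sup>2 - 2 * b * p * q + a * q\<^sup>2))" for p q
  proof -
    have det: "(a - p\<^sup>2) * (c - q\<^sup>2) - (b - p * q)\<^sup>2 = \<Delta> - (c * p\<^sup>2 - 2 * b * p * q + a * q\<^sup>2)"
      unfolding \<Delta>_def by algebra
    have ex: "exp (- (A * (a - p\<^sup>2) + (c - q\<^sup>2)) / 2) * exp (- (A * p\<^sup>2 + q\<^sup>2) / 2) = exp (- (A * a + c) / 2)"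
      unfolding exp_add[symmetric] by (simp add: field_simps)
    have "wishart_density m A (w - sq_map (p, q)) * gauss_density A (p, q)
      = A powr (real m / 2) / (4 * pi * fact (m - 2)) * (sqrt A / (2 * pi)) *
        (exp (- (A * (a - p\<^sup>2) + (c - q\<^sup>2)) / 2) * exp (- (A * p\<^sup>2 + q\<^sup>2) / 2))
        * ((\<Delta> - (c * p\<^sup>2 - 2 * b * p * q + a * q\<^sup>2)) powr r
        * (if 0 < a - p\<^sup>2 \<and> (b - p * q)\<^sup>2 < (a - p\<^sup>2) * (c - q\<^sup>2) then 1 else 0))"
      by (simp only: wishart_density_def gauss_density_def w sq_map_def fst_conv snd_conv
          minus_prod_def prod.case det r_def mult_ac)
    also have "\<dots> = K * ((\<Delta> - (c * p\<^sup>2 - 2 * b * p * q + a * q\<^sup>2)) powr r * (of_bool P *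
           indicator {..<\<Delta>} (c * p\<^sup>2 - 2 * b * p * q + a * q\<^sup>2)))"
      unfolding ex K_def posdef_minus_rank_one_iff by (auto simp: P_def \<Delta>_def)
    finally show ?thesis by (simp only: mult_ac)
  qed
  have "(\<integral>\<^sup>+u. ennreal (wishart_density m A (w - sq_map u)) * ennreal (gauss_density A u) \<partial>lborel)
     = (\<integral>\<^sup>+u. ennreal (wishart_density m A (w - sq_map u) * gauss_density A u) \<partial>lborel)"
    using A by (simp add: ennreal_mult'' gauss_density_nonneg)
  also have "\<dots> = (\<integral>\<^sup>+p. \<integral>\<^sup>+q. ennreal (wishart_density m A (w - sq_map (p, q)) * gauss_density A (p, q)) \<partial>lborel \<partial>lborel)"
    by (subst lborel_prod[symmetric], subst lborel.nn_integral_fst[symmetric])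
       (simp_all only: borel_prod lborel_prod, measurable)
  also have "\<dots> = (\<integral>\<^sup>+p. \<integral>\<^sup>+q. ennreal (K * of_bool P) * ennreal ((\<Delta> - (c * p\<^sup>2 - 2 * b * p * q + a * q\<^sup>2)) powr r
           * indicator {..<\<Delta>} (c * p\<^sup>2 - 2 * b * p * q + a * q\<^sup>2)) \<partial>lborel \<partial>lborel)"
    unfolding eq using K by (simp add: ennreal_mult')
  also have "\<dots> = ennreal (K * of_bool P) * (\<integral>\<^sup>+p. \<integral>\<^sup>+q. ennreal ((\<Delta> - (c * p\<^sup>2 - 2 * b * p * q + a * q\<^sup>2)) powr r
           * indicator {..<\<Delta>} (c * p\<^sup>2 - 2 * b * p * q + a * q\<^sup>2)) \<partial>lborel \<partial>lborel)"
    by (subst nn_integral_cmult[symmetric], measurable, subst nn_integral_cmult[symmetric], measurable)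
  also have "\<dots> = ennreal (wishart_density (Suc m) A w)"
  proof (cases P)
    case True
    then have \<Delta>: "0 < \<Delta>" by (simp add: P_def \<Delta>_def)
    have "ennreal (K * of_bool P) * (\<integral>\<^sup>+p. \<integral>\<^sup>+q. ennreal ((\<Delta> - (c * p\<^sup>2 - 2 * b * p * q + a * q\<^sup>2)) powr r
           * indicator {..<\<Delta>} (c * p\<^sup>2 - 2 * b * p * q + a * q\<^sup>2)) \<partial>lborel \<partial>lborel)
       = ennreal K * (ennreal (pi / sqrt \<Delta>) * ennreal (\<Delta> powr (r + 1) / (r + 1)))"
      using True \<Delta> r unfolding \<Delta>_def[symmetric]
      by (subst nn_integral_quadratic_form[where F = "\<lambda>x. ennreal ((\<Delta> - x) powr r * indicator {..<\<Delta>} x)"])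
         (simp_all add: P_def nn_integral_truncated_powr flip: \<Delta>_def)
    also have "\<dots> = ennreal (K * (pi / sqrt \<Delta> * (\<Delta> powr (r + 1) / (r + 1))))"
      using \<Delta> by (subst ennreal_mult'[OF K], subst ennreal_mult') auto
    also have "K * (pi / sqrt \<Delta> * (\<Delta> powr (r + 1) / (r + 1))) = wishart_density (Suc m) A w"
    proof -
      \<comment> \<open>The constants close up here: \<open>1 / (2 * pi)\<close> from the Gaussian,
        \<open>pi\<close> from the radial integral and \<open>1 / (r + 1) = 2 / (m - 1)\<close>
        multiply to \<open>1 / (m - 1)\<close>, the factor that extends the factorial.\<close>
      have f: "fact (Suc m - 2) = (fact (m - 2) :: real) * (real m - 1)"
        using m by (cases m rule: nat.exhaust; cases "m - 1") (auto simp: Suc_diff_le fact_Suc algebra_simps)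
      have 1: "\<Delta> powr (r + 1) / sqrt \<Delta> = \<Delta> powr ((real (Suc m) - 3) / 2)"
        using \<Delta> by (simp add: r_def powr_half_sqrt[symmetric] flip: powr_diff) (simp add: field_simps)
      have 2: "A powr (real m / 2) * sqrt A = A powr (real (Suc m) / 2)"
        using A by (simp add: powr_half_sqrt[symmetric] flip: powr_add) (simp add: field_simps)
      have "K * (pi / sqrt \<Delta> * (\<Delta> powr (r + 1) / (r + 1)))
        = (A powr (real m / 2) * sqrt A) / (4 * pi * (fact (m - 2) * (real m - 1))) * (\<Delta> powr (r + 1) / sqrt \<Delta>) * exp (- (A * a + c) / 2)"
        using m \<Delta> by (simp add: K_def r_def field_simps)
      also have "\<dots> = wishart_density (Suc m) A w"
        unfolding 1 2 f[symmetric] using True by (simp add: wishart_density_def w P_def \<Delta>_def)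
      finally show ?thesis .
    qed
    finally show ?thesis .
  qed (auto simp: P_def w wishart_density_def)
  finally show ?thesis .
qed

section \<open>The density of the Gram matrix\<close>

lemma nn_integral_lborel_pair:
  fixes F :: "'a::euclidean_space \<times> 'b::euclidean_space \<Rightarrow> ennreal"
  assumes [measurable]: "F \<in> borel_measurable borel"
  shows "(\<integral>\<^sup>+u. F u \<partial>lborel) = (\<integral>\<^sup>+p. \<integral>\<^sup>+q. F (p, q) \<partial>lborel \<partial>lborel)"
  by (subst lborel_prod[symmetric], subst lborel.nn_integral_fst[symmetric])
     (simp_all add: lborel_prod)

text \<open>With rows \<open>p\<close> and \<open>q\<close>, let \<open>b\<close> be their inner
  product and \<open>k = p1 * q2 - p2 * q1\<close>. Lagrange's identity
  \<open>b^2 + k^2 = s * c\<close> says that \<open>(b, k)\<close> is an orthogonal coordinate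
  system for \<open>q\<close> up to scale, and that \<open>k^2 = s * c - b^2\<close>. Passing from
  \<open>k\<close> to \<open>c\<close> gives the inverse square root, with both signs of
  \<open>k\<close> accounted for.\<close>

lemma nn_integral_det_coordinates:
  fixes G :: "real \<Rightarrow> real \<Rightarrow> ennreal" and p1 p2 :: real
  assumes [measurable]: "case_prod G \<in> borel_measurable borel" and p2: "p2 \<noteq> (0::real)"
  defines "s \<equiv> p1\<^sup>2 + p2\<^sup>2"
  shows "(\<integral>\<^sup>+q1. \<integral>\<^sup>+q2. G (p1 * q1 + p2 * q2) (q1\<^sup>2 + q2\<^sup>2) \<partial>lborel \<partial>lborel)
    = (\<integral>\<^sup>+b. \<integral>\<^sup>+c. G b c * ennreal (1 / sqrt (s * c - b\<^sup>2)) * indicator {0<..} (s * c - b\<^sup>2) \<partial>lborel \<partial>lborel)"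
proof -
  have [measurable (raw)]: "(\<lambda>x. G (f x) (g x)) \<in> borel_measurable M"
    if [measurable]: "f \<in> borel_measurable M" "g \<in> borel_measurable M" for M :: "'x measure" and f g
  proof -
    have "(\<lambda>x. case_prod G (f x, g x)) \<in> borel_measurable M"
      by measurable
    then show ?thesis by simp
  qed
  have s: "0 < s" using p2 by (auto simp: s_def intro: add_nonneg_pos)
  have "(\<integral>\<^sup>+q1. \<integral>\<^sup>+q2. G (p1 * q1 + p2 * q2) (q1\<^sup>2 + q2\<^sup>2) \<partial>lborel \<partial>lborel)
    = (\<integral>\<^sup>+q1. ennreal (1 / \<bar>p2\<bar>) * (\<integral>\<^sup>+b. G b (q1\<^sup>2 + ((b - p1 * q1) / p2)\<^sup>2) \<partial>lborel) \<partial>lborel)"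
  proof (intro nn_integral_cong)
    fix q1
    show "(\<integral>\<^sup>+q2. G (p1 * q1 + p2 * q2) (q1\<^sup>2 + q2\<^sup>2) \<partial>lborel)
      = ennreal (1 / \<bar>p2\<bar>) * (\<integral>\<^sup>+b. G b (q1\<^sup>2 + ((b - p1 * q1) / p2)\<^sup>2) \<partial>lborel)"
    proof -
      have "- p1 * q1 / p2 + 1 / p2 * b = (b - p1 * q1) / p2" "p1 * q1 + p2 * ((b - p1 * q1) / p2) = b" for b
        using p2 by (simp add: diff_divide_distrib) (use p2 in simp)
      then show ?thesis
        using p2 by (subst nn_integral_real_affine[where c = "1 / p2" and t = "- p1 * q1 / p2"])
          (simp_all only:, auto)
    qed
  qed
  also have "\<dots> = ennreal (1 / \<bar>p2\<bar>) * (\<integral>\<^sup>+q1. \<integral>\<^sup>+b. G b (q1\<^sup>2 + ((b - p1 * q1) / p2)\<^sup>2) \<partial>lborel \<partial>lborel)"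
    by (rule nn_integral_cmult) measurable
  also have "(\<integral>\<^sup>+q1. \<integral>\<^sup>+b. G b (q1\<^sup>2 + ((b - p1 * q1) / p2)\<^sup>2) \<partial>lborel \<partial>lborel)
    = (\<integral>\<^sup>+b. \<integral>\<^sup>+q1. G b (q1\<^sup>2 + ((b - p1 * q1) / p2)\<^sup>2) \<partial>lborel \<partial>lborel)"
    by (rule lborel_pair.Fubini') measurable
  also have "\<dots> = (\<integral>\<^sup>+b. ennreal (\<bar>p2\<bar> / s) * (\<integral>\<^sup>+k. G b (b\<^sup>2 / s + k\<^sup>2 * (1 / s)) \<partial>lborel) \<partial>lborel)"
  proof (intro nn_integral_cong)
    fix b
    \<comment> \<open>Here \<open>q1\<close> is expressed by \<open>b\<close> and the determinant
      \<open>k\<close>; the left-hand side is \<open>q1^2 + q2^2\<close>, that is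
      \<open>c\<close>.\<close>
    have "(p1 * b / s + (- p2 / s) * k)\<^sup>2 + ((b - p1 * (p1 * b / s + (- p2 / s) * k)) / p2)\<^sup>2
        = b\<^sup>2 / s + k\<^sup>2 * (1 / s)" for k
    proof -
      have "b - p1 * (p1 * b / s + (- p2 / s) * k) = p2 * (p2 * b + p1 * k) / s"
        using s by (simp add: field_simps) (simp add: s_def power2_eq_square algebra_simps)
      then have "(b - p1 * (p1 * b / s + (- p2 / s) * k)) / p2 = (p2 * b + p1 * k) / s"
        using p2 by simp
      moreover have "p1 * b / s + (- p2 / s) * k = (p1 * b - p2 * k) / s"
        by (simp add: diff_divide_distrib)
      moreover have "(p1 * b - p2 * k)\<^sup>2 + (p2 * b + p1 * k)\<^sup>2 = s * (b\<^sup>2 + k\<^sup>2)"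
        unfolding s_def by algebra
      ultimately show ?thesis
        using s by (simp add: power_divide add_divide_distrib[symmetric] power2_eq_square[of s])
    qed
    then show "(\<integral>\<^sup>+q1. G b (q1\<^sup>2 + ((b - p1 * q1) / p2)\<^sup>2) \<partial>lborel)
      = ennreal (\<bar>p2\<bar> / s) * (\<integral>\<^sup>+k. G b (b\<^sup>2 / s + k\<^sup>2 * (1 / s)) \<partial>lborel)"
      using p2 s by (subst nn_integral_real_affine[where c = "- p2 / s" and t = "p1 * b / s"])
        (simp_all only:, auto)
  qed
  also have "\<dots> = (\<integral>\<^sup>+b. ennreal \<bar>p2\<bar> * (\<integral>\<^sup>+c. G b c * ennreal (1 / sqrt (s * c - b\<^sup>2)) * indicator {0<..} (s * c - b\<^sup>2) \<partial>lborel) \<partial>lborel)"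
  proof (intro nn_integral_cong)
    fix b
    \<comment> \<open>Away from \<open>k = 0\<close> the inserted factors cancel, since
      \<open>s * (k^2 / s)\<close> is \<open>k^2\<close>. They supply the weight
      \<open>\<bar>k\<bar>\<close> required for the substitution by squares.\<close>
    have "(\<integral>\<^sup>+k. G b (b\<^sup>2 / s + k\<^sup>2 * (1 / s)) \<partial>lborel)
      = (\<integral>\<^sup>+k. G b (b\<^sup>2 / s + k\<^sup>2 * (1 / s)) * ennreal (1 / sqrt (s * (k\<^sup>2 * (1 / s)))) * ennreal \<bar>k\<bar> \<partial>lborel)"
      using s by (intro nn_integral_cong_AE eventually_mono[OF AE_lborel_singleton[of 0]])
        (auto simp: mult.assoc ennreal_mult'[symmetric])
    also have "\<dots> = ennreal s * (\<integral>\<^sup>+y\<in>{0<..}. G b (b\<^sup>2 / s + y) * ennreal (1 / sqrt (s * y)) \<partial>lborel)"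
      using s by (subst nn_integral_square_scaled[where F = "\<lambda>y. G b (b\<^sup>2 / s + y) * ennreal (1 / sqrt (s * y))"]) auto
    also have "(\<integral>\<^sup>+y\<in>{0<..}. G b (b\<^sup>2 / s + y) * ennreal (1 / sqrt (s * y)) \<partial>lborel)
      = (\<integral>\<^sup>+c. G b c * ennreal (1 / sqrt (s * c - b\<^sup>2)) * indicator {0<..} (s * c - b\<^sup>2) \<partial>lborel)"
      using s by (subst (2) nn_integral_real_affine[where c = 1 and t = "b\<^sup>2 / s"])
        (auto simp: distrib_left zero_less_mult_iff split: split_indicator intro!: nn_integral_cong)
    finally show "ennreal (\<bar>p2\<bar> / s) * (\<integral>\<^sup>+k. G b (b\<^sup>2 / s + k\<^sup>2 * (1 / s)) \<partial>lborel)
      = ennreal \<bar>p2\<bar> * (\<integral>\<^sup>+c. G b c * ennreal (1 / sqrt (s * c - b\<^sup>2)) * indicator {0<..} (s * c - b\<^sup>2) \<partial>lborel)"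
      using s by (simp add: mult.assoc[symmetric] ennreal_mult'[symmetric])
  qed
  also have "\<dots> = ennreal \<bar>p2\<bar> * (\<integral>\<^sup>+b. \<integral>\<^sup>+c. G b c * ennreal (1 / sqrt (s * c - b\<^sup>2)) * indicator {0<..} (s * c - b\<^sup>2) \<partial>lborel \<partial>lborel)"
    by (rule nn_integral_cmult) measurable
  finally show ?thesis
    using p2 by (simp add: mult.assoc[symmetric] ennreal_mult'[symmetric])
qed

text \<open>For a fixed first row the determinant coordinates produce a function of its squared
  length only, so the first row is integrated radially. The two Gaussian constants give
  \<open>A / (4 * pi^2)\<close> and the radial integral a factor \<open>pi\<close>: this is where
  \<open>A / (4 * pi)\<close> comes from.\<close>

lemma wishart_density_base:
  assumes A: "0 < A" and [measurable]: "F \<in> borel_measurable borel"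
  shows "(\<integral>\<^sup>+u. (\<integral>\<^sup>+v. F (sq_map u + sq_map v) * ennreal (gauss_density A v) \<partial>lborel) * ennreal (gauss_density A u) \<partial>lborel)
       = (\<integral>\<^sup>+w. F w * ennreal (wishart_density 2 A w) \<partial>lborel)"
proof -
  define G where "G = (\<lambda>w. F w * ennreal (A / (4 * pi\<^sup>2) * exp (- (A * fst w + snd (snd w)) / 2)))"
  have [measurable]: "G \<in> borel_measurable borel"
    unfolding G_def by (intro borel_measurable_times_ennreal assms measurable_compose[OF _ measurable_ennreal]
      borel_measurable_continuous_onI continuous_intros) auto
  define H where "H = (\<lambda>a. \<integral>\<^sup>+b. \<integral>\<^sup>+c. G (a, b, c) * ennreal (1 / sqrt (a * c - b\<^sup>2)) * indicator {0<..} (a * c - b\<^sup>2) \<partial>lborel \<partial>lborel)"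
  have [measurable]: "H \<in> borel_measurable borel"
    unfolding H_def by measurable
  have G: "F (sq_map (p1, q1) + sq_map (p2, q2)) * ennreal (gauss_density A (p2, q2)) * ennreal (gauss_density A (p1, q1))
     = G (p1\<^sup>2 + p2\<^sup>2, p1 * q1 + p2 * q2, q1\<^sup>2 + q2\<^sup>2)" for p1 q1 p2 q2
  proof -
    have "gauss_density A (p2, q2) * gauss_density A (p1, q1) =
      (sqrt A * sqrt A) / (4 * pi\<^sup>2) * (exp (- (A * p2\<^sup>2 + q2\<^sup>2) / 2) * exp (- (A * p1\<^sup>2 + q1\<^sup>2) / 2))"
      unfolding gauss_density_def fst_conv snd_conv by (simp only: power2_eq_square) (simp add: field_simps)
    also have "\<dots> = A / (4 * pi\<^sup>2) * exp (- (A * (p1\<^sup>2 + p2\<^sup>2) + (q1\<^sup>2 + q2\<^sup>2)) / 2)"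
      using A unfolding exp_add[symmetric] by (simp add: algebra_simps add_divide_distrib diff_divide_distrib)
    finally show ?thesis
      by (simp only: G_def sq_map_def fst_conv snd_conv add_Pair mult.assoc
          ennreal_mult'[symmetric] gauss_density_nonneg[OF A])
  qed
  have "(\<integral>\<^sup>+u. (\<integral>\<^sup>+v. F (sq_map u + sq_map v) * ennreal (gauss_density A v) \<partial>lborel) * ennreal (gauss_density A u) \<partial>lborel)
    = (\<integral>\<^sup>+u. \<integral>\<^sup>+v. F (sq_map u + sq_map v) * ennreal (gauss_density A v) * ennreal (gauss_density A u) \<partial>lborel \<partial>lborel)"
    by (intro nn_integral_cong nn_integral_multc[symmetric]) measurable
  also have "\<dots> = (\<integral>\<^sup>+p1. \<integral>\<^sup>+q1. \<integral>\<^sup>+p2. \<integral>\<^sup>+q2. G (p1\<^sup>2 + p2\<^sup>2, p1 * q1 + p2 * q2, q1\<^sup>2 + q2\<^sup>2)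
       \<partial>lborel \<partial>lborel \<partial>lborel \<partial>lborel)"
    unfolding G[symmetric]
    by (subst nn_integral_lborel_pair, measurable, intro nn_integral_cong, subst nn_integral_lborel_pair, measurable)
  also have "\<dots> = (\<integral>\<^sup>+p1. \<integral>\<^sup>+p2. \<integral>\<^sup>+q1. \<integral>\<^sup>+q2. G (p1\<^sup>2 + p2\<^sup>2, p1 * q1 + p2 * q2, q1\<^sup>2 + q2\<^sup>2)
       \<partial>lborel \<partial>lborel \<partial>lborel \<partial>lborel)"
    by (intro nn_integral_cong lborel_pair.Fubini') measurable
  also have "\<dots> = (\<integral>\<^sup>+p1. \<integral>\<^sup>+p2. H (p1\<^sup>2 + p2\<^sup>2) \<partial>lborel \<partial>lborel)"
  proof (rule nn_integral_cong, rule nn_integral_cong_AE, use AE_lborel_singleton[of 0] in eventually_elim)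
    fix p1 p2 :: real assume "p2 \<noteq> 0"
    moreover have "(\<lambda>(b, c). G (p1\<^sup>2 + p2\<^sup>2, b, c)) = (\<lambda>x. G (p1\<^sup>2 + p2\<^sup>2, x))"
      by auto
    ultimately show "(\<integral>\<^sup>+q1. \<integral>\<^sup>+q2. G (p1\<^sup>2 + p2\<^sup>2, p1 * q1 + p2 * q2, q1\<^sup>2 + q2\<^sup>2) \<partial>lborel \<partial>lborel) = H (p1\<^sup>2 + p2\<^sup>2)"
      unfolding H_def
      by (intro nn_integral_det_coordinates) simp_all
  qed
  also have "\<dots> = ennreal pi * (\<integral>\<^sup>+a\<in>{0<..}. H a \<partial>lborel)"
    by (rule nn_integral_polar_radial) measurable
  also have "\<dots> = (\<integral>\<^sup>+a. \<integral>\<^sup>+b. \<integral>\<^sup>+c. ennreal pi * (G (a, b, c) * ennreal (1 / sqrt (a * c - b\<^sup>2)) * indicator {0<..} (a * c - b\<^sup>2) * indicator {0<..} a)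
      \<partial>lborel \<partial>lborel \<partial>lborel)"
    unfolding H_def
    by (simp add: nn_integral_cmult nn_integral_multc)
  also have "\<dots> = (\<integral>\<^sup>+a. \<integral>\<^sup>+b. \<integral>\<^sup>+c. F (a, b, c) * ennreal (wishart_density 2 A (a, b, c)) \<partial>lborel \<partial>lborel \<partial>lborel)"
  proof (intro nn_integral_cong)
    fix a b c :: real
    show "ennreal pi * (G (a, b, c) * ennreal (1 / sqrt (a * c - b\<^sup>2)) * indicator {0<..} (a * c - b\<^sup>2) * indicator {0<..} a)
      = F (a, b, c) * ennreal (wishart_density 2 A (a, b, c))"
    proof (cases "0 < a \<and> b\<^sup>2 < a * c")
      case True
      have e: "(2 - 3) / 2 = - (1 / 2 :: real)" by simp
      have *: "wishart_density 2 A (a, b, c) = pi * (A / (4 * pi\<^sup>2) * exp (- (A * a + c) / 2) * (1 / sqrt (a * c - b\<^sup>2)))"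
        using True A by (simp add: wishart_density_def e powr_minus powr_half_sqrt)
          (simp add: field_simps power2_eq_square)
      show ?thesis
        unfolding * using True A
        by (subst ennreal_mult', simp, subst ennreal_mult') (simp_all add: G_def mult_ac)
    qed (auto simp: wishart_density_def)
  qed
  also have "\<dots> = (\<integral>\<^sup>+w. F w * ennreal (wishart_density 2 A w) \<partial>lborel)"
    by (subst nn_integral_lborel_pair, measurable, subst nn_integral_lborel_pair, measurable)
  finally show ?thesis .
qed

text \<open>The columns may live in any space \<open>N\<close>; only the image of one column under
  \<open>T\<close> is prescribed. Thus the rotation is transported one factor at a time, and the
  product measure itself is never pushed forward.\<close>

lemma nn_integral_wishart_density:
  fixes N :: "'b measure" and T :: "'b \<Rightarrow> real \<times> real"
  assumes "prob_space N" and A: "0 < A" and T [measurable]: "T \<in> N \<rightarrow>\<^sub>M borel"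
    and dT: "distr N borel T = density lborel (\<lambda>u. ennreal (gauss_density A u))"
    and m: "2 \<le> m" and "F \<in> borel_measurable borel"
  shows "(\<integral>\<^sup>+X. F (\<Sum>j<m. sq_map (T (X j))) \<partial>(\<Pi>\<^sub>M j\<in>{..<m}. N))
       = (\<integral>\<^sup>+w. F w * ennreal (wishart_density m A w) \<partial>lborel)"
proof -
  interpret N: prob_space N by fact
  interpret P: product_sigma_finite "\<lambda>_::nat. N" by standard
  have N: "(\<integral>\<^sup>+x. f (T x) \<partial>N) = (\<integral>\<^sup>+u. f u * ennreal (gauss_density A u) \<partial>lborel)"
    if [measurable]: "f \<in> borel_measurable borel" for f
  proof -
    have "(\<integral>\<^sup>+x. f (T x) \<partial>N) = (\<integral>\<^sup>+u. f u \<partial>distr N borel T)"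
      by (subst nn_integral_distr) auto
    then show ?thesis
      unfolding dT by (subst (asm) nn_integral_density) (auto simp: mult.commute)
  qed
  have Suc_split: "(\<integral>\<^sup>+X. F (\<Sum>j<Suc k. sq_map (T (X j))) \<partial>(\<Pi>\<^sub>M j\<in>{..<Suc k}. N))
    = (\<integral>\<^sup>+y. \<integral>\<^sup>+X. F (sq_map (T y) + (\<Sum>j<k. sq_map (T (X j)))) \<partial>(\<Pi>\<^sub>M j\<in>{..<k}. N) \<partial>N)"
    if [measurable]: "F \<in> borel_measurable borel" for F :: "real \<times> real \<times> real \<Rightarrow> ennreal" and k
    by (simp only: lessThan_Suc, subst P.product_nn_integral_insert_rev)
       (auto intro!: nn_integral_cong arg_cong[of _ _ F] sum.cong)
  show ?thesis
    using m \<open>F \<in> borel_measurable borel\<close>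
  proof (induction m arbitrary: F rule: dec_induct)
    case base
    note [measurable] = base
    have "(\<integral>\<^sup>+X. F (\<Sum>j<2::nat. sq_map (T (X j))) \<partial>(\<Pi>\<^sub>M j\<in>{..<2::nat}. N))
       = (\<integral>\<^sup>+y. \<integral>\<^sup>+x. F (sq_map (T y) + sq_map (T x)) \<partial>N \<partial>N)"
      unfolding numeral_2_eq_2 Suc_split[OF base]
    proof (rule nn_integral_cong)
      fix y
      show "(\<integral>\<^sup>+X. F (sq_map (T y) + (\<Sum>j<Suc 0. sq_map (T (X j)))) \<partial>(\<Pi>\<^sub>M j\<in>{..<Suc 0}. N))
        = (\<integral>\<^sup>+x. F (sq_map (T y) + sq_map (T x)) \<partial>N)"
        using Suc_split[of "\<lambda>w. F (sq_map (T y) + w)" 0]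
        by (simp add: emeasure_PiM_empty space_PiM_empty del: lessThan_Suc)
    qed
    also have "\<dots> = (\<integral>\<^sup>+u. (\<integral>\<^sup>+v. F (sq_map u + sq_map v) * ennreal (gauss_density A v) \<partial>lborel) * ennreal (gauss_density A u) \<partial>lborel)"
      by (subst N, measurable, subst N, measurable)
    also have "\<dots> = (\<integral>\<^sup>+w. F w * ennreal (wishart_density 2 A w) \<partial>lborel)"
      by (rule wishart_density_base) (fact A base)+
    finally show ?case .
  next
    case (step k)
    note [measurable] = step.prems
    have "(\<integral>\<^sup>+X. F (\<Sum>j<Suc k. sq_map (T (X j))) \<partial>(\<Pi>\<^sub>M j\<in>{..<Suc k}. N))
       = (\<integral>\<^sup>+y. \<integral>\<^sup>+w. F (sq_map (T y) + w) * ennreal (wishart_density k A w) \<partial>lborel \<partial>N)"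
      by (subst Suc_split) (auto intro!: nn_integral_cong step.IH)
    also have "\<dots> = (\<integral>\<^sup>+u. (\<integral>\<^sup>+w. F (sq_map u + w) * ennreal (wishart_density k A w) \<partial>lborel) * ennreal (gauss_density A u) \<partial>lborel)"
      by (subst N) auto
    \<comment> \<open>Translation invariance moves the rank-one term from the test function to the
      density. After the exchange of integrals \<open>F w\<close> comes out, and the inner integral
      is the convolution computed in \<open>wishart_density_step\<close>.\<close>
    also have "\<dots> = (\<integral>\<^sup>+u. \<integral>\<^sup>+w. F w * (ennreal (wishart_density k A (w - sq_map u)) * ennreal (gauss_density A u)) \<partial>lborel \<partial>lborel)"
    proof (intro nn_integral_cong)
      fix u
      have "(\<integral>\<^sup>+w. F w * ennreal (wishart_density k A (w - sq_map u)) \<partial>lborel)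
        = (\<integral>\<^sup>+w. F w * ennreal (wishart_density k A (w - sq_map u)) \<partial>distr lborel borel ((+) (sq_map u)))"
        by (simp add: lborel_distr_plus)
      also have "\<dots> = (\<integral>\<^sup>+w. F (sq_map u + w) * ennreal (wishart_density k A w) \<partial>lborel)"
        by (subst nn_integral_distr) auto
      finally show "(\<integral>\<^sup>+w. F (sq_map u + w) * ennreal (wishart_density k A w) \<partial>lborel) * ennreal (gauss_density A u)
        = (\<integral>\<^sup>+w. F w * (ennreal (wishart_density k A (w - sq_map u)) * ennreal (gauss_density A u)) \<partial>lborel)"
        by (simp add: nn_integral_multc mult.assoc[symmetric])
    qed
    also have "\<dots> = (\<integral>\<^sup>+w. \<integral>\<^sup>+u. F w * (ennreal (wishart_density k A (w - sq_map u)) * ennreal (gauss_density A u)) \<partial>lborel \<partial>lborel)"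
      by (rule lborel_pair.Fubini') measurable
    also have "\<dots> = (\<integral>\<^sup>+w. F w * ennreal (wishart_density (Suc k) A w) \<partial>lborel)"
      using A step.hyps by (simp add: nn_integral_cmult wishart_density_step)
    finally show ?case .
  qed
qed

section \<open>Substitutions for the angle\<close>

lemma nn_integral_power_times_exp_scaled:
  assumes k: "0 < (k::real)"
  shows "(\<integral>\<^sup>+b\<in>{0<..}. ennreal (b ^ n * exp (- (b * k) / 2)) \<partial>lborel) = ennreal (fact n * (2 / k) ^ Suc n)"
proof -
  have "(\<integral>\<^sup>+b\<in>{0<..}. ennreal (b ^ n * exp (- (b * k) / 2)) \<partial>lborel)
     = (\<integral>\<^sup>+x. ennreal ((2 / k) ^ Suc n) * (ennreal (x ^ n * exp (- x)) * indicator {0..} x) \<partial>lborel)"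
    using k by (subst nn_integral_real_affine[where c = "2 / k" and t = 0], simp, simp, subst nn_integral_cmult[symmetric], simp)
      (auto intro!: nn_integral_cong_AE eventually_mono[OF AE_lborel_singleton[of 0]]
        simp: ennreal_mult'[symmetric] power_divide power_mult_distrib zero_less_divide_iff zero_less_mult_iff split: split_indicator)
  also have "\<dots> = ennreal ((2 / k) ^ Suc n) * ennreal (fact n)"
    using nn_intergal_power_times_exp_Ici[of n] by (subst nn_integral_cmult) auto
  finally show ?thesis
    by (subst ennreal_mult') (auto simp: mult_ac)
qed

text \<open>For eigenvalues with ratio \<open>t\<close>, the fraction
  \<open>(1 + t) / (1 - t)\<close> is their sum divided by their difference. It maps the unit
  interval increasingly onto the ray beyond 1.\<close>

lemma nn_integral_cayley:
  fixes f :: "real \<Rightarrow> ennreal"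
  assumes [measurable]: "f \<in> borel_measurable borel"
  shows "(\<integral>\<^sup>+x\<in>{1<..}. f x \<partial>lborel)
    = (\<integral>\<^sup>+t\<in>{0<..<1}. f ((1 + t) / (1 - t)) * ennreal (2 / (1 - t)\<^sup>2) \<partial>lborel)"
proof -
  have ei: "einterval 0 1 = {0<..<1}"
    by (auto simp: einterval_def zero_ereal_def one_ereal_def)
  have img: "(\<lambda>t. (1 + t) / (1 - t)) ` {0<..<1} = {1::real<..}"
  proof (intro equalityI subsetI)
    fix x :: real assume "x \<in> {1<..}"
    then show "x \<in> (\<lambda>t. (1 + t) / (1 - t)) ` {0<..<1}"
      by (intro image_eqI[of _ _ "(x - 1) / (x + 1)"]) (auto simp: field_simps)
  qed (auto simp: field_simps)
  have "(\<integral>\<^sup>+x. f x * indicator ((\<lambda>t. (1 + t) / (1 - t)) ` einterval 0 1) x \<partial>lborel)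
     = (\<integral>\<^sup>+t. f ((1 + t) / (1 - t)) * ennreal (2 / (1 - t)\<^sup>2) * indicator (einterval 0 1) t \<partial>lborel)"
  proof (rule nn_integral_substitution_einterval)
    fix x :: real assume "x \<in> einterval 0 1"
    then have x: "x < 1" by (simp add: ei)
    have "((\<lambda>t. (1 + t) / (1 - t)) has_real_derivative (1 * (1 - x) - (1 + x) * (- 1)) / ((1 - x) * (1 - x))) (at x)"
      using x by (intro derivative_eq_intros) auto
    then show "((\<lambda>t. (1 + t) / (1 - t)) has_real_derivative 2 / (1 - x)\<^sup>2) (at x)"
      by (simp add: power2_eq_square)
  qed (auto simp: ei intro!: continuous_intros)
  then show ?thesis
    unfolding ei img .
qed

text \<open>If \<open>z\<close> is the squared cosine of an angle, the quotient is the cotangent of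
  the doubled angle and \<open>2 * sqrt (z * (1 - z))\<close> its sine; the identity is
  \<open>1 + cot^2 = 1 / sin^2\<close>.\<close>

lemma one_plus_cotangent_square:
  fixes z :: real
  assumes z: "0 < z" "z < 1"
  shows "1 + ((2 * z - 1) / (2 * sqrt (z * (1 - z))))\<^sup>2 = 1 / (4 * (z * (1 - z)))"
proof -
  define w where "w = z * (1 - z)"
  have w: "0 < w" "(2 * z - 1)\<^sup>2 = 1 - 4 * w" using z by (auto simp: w_def power2_eq_square algebra_simps)
  show ?thesis
    unfolding w_def[symmetric] using w by (simp add: power_divide power_mult_distrib) (simp add: field_simps)
qed

text \<open>Both weights are constant multiples of the uniform measure on an angle: Cauchy in terms
  of its cotangent, arcsine in terms of the squared cosine of its half. The arcsine weight is the
  factor \<open>z powr (-1/2) * (1 - z) powr (-1/2)\<close> of the final density. Since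
  \<open>g\<close> increases while \<open>s\<close> decreases in \<open>z\<close>, the line is
  reflected before substituting.\<close>

lemma nn_integral_cosine_substitution:
  fixes f :: "real \<Rightarrow> ennreal"
  assumes [measurable]: "f \<in> borel_measurable borel"
  defines "g \<equiv> \<lambda>z::real. (2 * z - 1) / (2 * sqrt (z * (1 - z)))"
  shows "(\<integral>\<^sup>+s. f s * ennreal (1 / (1 + s\<^sup>2)) \<partial>lborel)
    = (\<integral>\<^sup>+z\<in>{0<..<1}. f (- g z) * ennreal (1 / sqrt (z * (1 - z))) \<partial>lborel)"
proof -
  have ei: "einterval 0 1 = {0<..<1}"
    by (auto simp: einterval_def zero_ereal_def one_ereal_def)
  have w: "0 < z * (1 - z)" if "z \<in> {0<..<1}" for z :: real
    using that by simp
  have g2: "1 + (g z)\<^sup>2 = 1 / (4 * (z * (1 - z)))" if "z \<in> {0<..<1}" for z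
    using one_plus_cotangent_square[of z] that by (simp add: g_def)
  have img: "g ` {0<..<1} = UNIV"
  proof (intro equalityI subsetI)
    fix s :: real
    define R where "R = sqrt (1 + s\<^sup>2)"
    \<comment> \<open>\<open>s / R\<close> is the cosine of the angle with cotangent
      \<open>s\<close>, and the half-angle formula inverts \<open>g\<close>.\<close>
    define z where "z = (1 + s / R) / 2"
    have R2: "R\<^sup>2 = 1 + s\<^sup>2" and R: "0 < R"
      by (auto simp: R_def add_pos_nonneg)
    have sR: "\<bar>s\<bar> < R" unfolding R_def by (intro real_less_rsqrt) auto
    have "z * (1 - z) = (1 / (2 * R))\<^sup>2"
      using R by (simp add: z_def field_simps R2 power2_eq_square[symmetric])
    then have rt: "sqrt (z * (1 - z)) = 1 / (2 * R)"
      using R by (simp add: real_sqrt_unique)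
    have nu: "2 * z - 1 = s / R"
      unfolding z_def by (simp add: field_simps)
    have "g z = (s / R) / (2 * (1 / (2 * R)))"
      by (simp only: g_def rt nu)
    then have "g z = s"
      using R by simp
    moreover have "z \<in> {0<..<1}"
      using R sR by (auto simp: z_def field_simps)
    ultimately show "s \<in> g ` {0<..<1}" by blast
  qed simp
  have "(\<integral>\<^sup>+s. f s * ennreal (1 / (1 + s\<^sup>2)) \<partial>lborel)
     = (\<integral>\<^sup>+s. f (- s) * ennreal (1 / (1 + s\<^sup>2)) * indicator (g ` einterval 0 1) s \<partial>lborel)"
    unfolding ei img by (subst nn_integral_real_affine[where c = "-1" and t = 0]) auto
  also have "\<dots> = (\<integral>\<^sup>+z. f (- g z) * ennreal (1 / (1 + (g z)\<^sup>2)) *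
      ennreal (1 / (4 * (z * (1 - z)) * sqrt (z * (1 - z)))) * indicator (einterval 0 1) z \<partial>lborel)"
  proof (rule nn_integral_substitution_einterval)
    fix z assume "z \<in> einterval 0 1"
    then have z: "0 < z" "z < 1" by (auto simp: ei)
    define q where "q = sqrt (z * (1 - z))"
    have q: "0 < q" "q\<^sup>2 = z * (1 - z)" using z by (auto simp: q_def)
    have d0: "((\<lambda>z. z * (1 - z)) has_real_derivative 1 - 2 * z) (at z)"
      by (auto intro!: derivative_eq_intros)
    have d: "((\<lambda>z. 2 * sqrt (z * (1 - z))) has_real_derivative 2 * ((1 - 2 * z) * (inverse q / 2))) (at z)"
      using DERIV_cmult[OF DERIV_chain2[OF DERIV_real_sqrt d0], of 2] z
      by (simp add: q_def mult_ac)
    have n: "((\<lambda>z. 2 * z - 1) has_real_derivative 2) (at z)"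
      by (auto intro!: derivative_eq_intros)
    have q0: "2 * sqrt (z * (1 - z)) \<noteq> 0"
      using z by simp
    have "(2 * (2 * q) - y * (2 * ((- y) * (inverse q / 2)))) / ((2 * q) * (2 * q)) = (4 * q\<^sup>2 + 2 * y\<^sup>2 * (1 / 2)) / (4 * q\<^sup>2 * q)" for y
      using q(1) by (simp add: field_simps power2_eq_square)
    from this[of "2 * z - 1"]
    have "(2 * (2 * q) - (2 * z - 1) * (2 * ((1 - 2 * z) * (inverse q / 2)))) / ((2 * q) * (2 * q))
       = (4 * q\<^sup>2 + (2 * z - 1)\<^sup>2) / (4 * q\<^sup>2 * q)"
      by simp
    also have "4 * q\<^sup>2 + (2 * z - 1)\<^sup>2 = 1"
      unfolding q(2) by algebra
    also have "1 / (4 * q\<^sup>2 * q) = 1 / (4 * (z * (1 - z)) * sqrt (z * (1 - z)))"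
      unfolding q(2) by (simp only: q_def)
    finally have e: "(2 * (2 * q) - (2 * z - 1) * (2 * ((1 - 2 * z) * (inverse q / 2)))) / ((2 * q) * (2 * q))
       = 1 / (4 * (z * (1 - z)) * sqrt (z * (1 - z)))"
      .
    show "(g has_real_derivative 1 / (4 * (z * (1 - z)) * sqrt (z * (1 - z)))) (at z)"
      using DERIV_divide[OF n d q0] unfolding g_def by (simp only: e[unfolded q_def] q_def)
  next
    show "continuous_on (einterval 0 1) (\<lambda>z. 1 / (4 * (z * (1 - z)) * sqrt (z * (1 - z))))"
      unfolding ei by (intro continuous_intros) auto
  next
    fix z assume "z \<in> einterval 0 1"
    then show "0 \<le> 1 / (4 * (z * (1 - z)) * sqrt (z * (1 - z)))"
      unfolding ei by simp
  qed (simp_all add: g_def)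
  also have "\<dots> = (\<integral>\<^sup>+z\<in>{0<..<1}. f (- g z) * ennreal (1 / sqrt (z * (1 - z))) \<partial>lborel)"
    unfolding ei
  proof (intro nn_integral_cong)
    fix z :: real
    show "f (- g z) * ennreal (1 / (1 + (g z)\<^sup>2)) *
      ennreal (1 / (4 * (z * (1 - z)) * sqrt (z * (1 - z)))) * indicator {0<..<1} z
      = f (- g z) * ennreal (1 / sqrt (z * (1 - z))) * indicator {0<..<1} z"
    proof (cases "z \<in> {0<..<1}")
      case True
      have "1 / (1 + (g z)\<^sup>2) * (1 / (4 * (z * (1 - z)) * sqrt (z * (1 - z)))) = 1 / sqrt (z * (1 - z))"
        unfolding g2[OF True] using True by simp
      moreover have "0 \<le> 1 / (1 + (g z)\<^sup>2)"
        by simp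
      ultimately have "ennreal (1 / (1 + (g z)\<^sup>2)) * ennreal (1 / (4 * (z * (1 - z)) * sqrt (z * (1 - z))))
         = ennreal (1 / sqrt (z * (1 - z)))"
        by (metis ennreal_mult')
      then show ?thesis
        by (simp only: mult.assoc)
    qed simp
  qed
  finally show ?thesis .
qed

lemma cosine_substitution_inverse:
  fixes z :: real
  assumes z: "0 < z" "z < 1"
  defines "s \<equiv> - ((2 * z - 1) / (2 * sqrt (z * (1 - z))))"
  shows "(1 - s / sqrt (1 + s\<^sup>2)) / 2 = z"
proof -
  have w: "0 < z * (1 - z)" using z by simp
  have "1 + s\<^sup>2 = (1 / (2 * sqrt (z * (1 - z))))\<^sup>2"
    using one_plus_cotangent_square[OF z] w by (simp add: s_def power_divide power_mult_distrib)
  then have "sqrt (1 + s\<^sup>2) = 1 / (2 * sqrt (z * (1 - z)))"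
    using w by (simp add: real_sqrt_unique)
  then show ?thesis
    using w z by (simp add: s_def)
qed

text \<open>Scaling the entries by \<open>x\<close> multiplies the determinant by the square of
  \<open>x\<close>. The result is kept as a quotient because \<open>m = 2\<close> is allowed, where
  \<open>m - 3\<close> is negative and would be truncated as a natural number.\<close>

lemma square_powr_half:
  fixes x :: real
  assumes "0 < x"
  shows "(x\<^sup>2) powr ((real m - 3) / 2) = x ^ m / x ^ 3"
proof -
  have e: "2 * (y / 2) = y" for y :: real
    by simp
  have "(x\<^sup>2) powr ((real m - 3) / 2) = (x powr 2) powr ((real m - 3) / 2)"
    using assms by (simp add: powr_numeral)
  also have "\<dots> = x powr (real m - 3)"
    unfolding powr_powr e ..
  also have "\<dots> = x ^ m / x ^ 3"
    using assms by (simp add: powr_diff powr_realpow powr_numeral)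
  finally show ?thesis .
qed

section \<open>The law of the eigenvector angle\<close>

text \<open>Up to a constant and the arcsine weight, the integrand is the joint density of the
  eigenvalue ratio \<open>t\<close> and of \<open>z\<close>, after the larger eigenvalue has been
  integrated out.\<close>

definition euler_type_integral :: "nat \<Rightarrow> real \<Rightarrow> real \<Rightarrow> ennreal" where
  "euler_type_integral m A z = (\<integral>\<^sup>+t\<in>{0<..<1}. ennreal (t powr ((real m - 3) / 2) * (1 - t)
     * (1 / (z + A * (1 - z) + (1 - z + A * z) * t)) ^ m) \<partial>lborel)"

lemma euler_type_integral_measurable [measurable]: "euler_type_integral m A \<in> borel_measurable borel"
  unfolding euler_type_integral_def[abs_def] by measurable

text \<open>With \<open>R = sqrt (1 + s^2)\<close> and \<open>y = - s + R * \<tau>\<close>, the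
  region \<open>1 < y * (y + 2 * s)\<close> becomes \<open>1 < \<tau>^2\<close>, and \<tau> is the
  trace divided by the eigenvalue gap \<open>2 * b * R\<close>. The Cayley substitution then
  expresses \<tau> by the eigenvalue ratio.\<close>

lemma nn_integral_hyperbola:
  fixes A s :: real
  assumes A: "0 < A"
  defines "z \<equiv> (1 - s / sqrt (1 + s\<^sup>2)) / 2"
  shows "(\<integral>\<^sup>+y. ennreal (if 0 < y + 2 * s \<and> 1 < y * (y + 2 * s)
      then (y * (y + 2 * s) - 1) powr ((real m - 3) / 2) * (1 / (y + A * (y + 2 * s))) ^ m else 0) \<partial>lborel)
    = ennreal (1 / (4 * (1 + s\<^sup>2))) * euler_type_integral m A z"
proof -
  define R where "R = sqrt (1 + s\<^sup>2)"
  define \<sigma> where "\<sigma> = s / R"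
  define r where "r = (real m - 3) / 2"
  have R2: "R\<^sup>2 = 1 + s\<^sup>2" and R: "0 < R"
    by (auto simp: R_def add_pos_nonneg)
  have sR: "\<bar>s\<bar> < R" unfolding R_def by (intro real_less_rsqrt) auto
  have "\<sigma> = 1 - 2 * z"
    unfolding z_def R_def[symmetric] \<sigma>_def[symmetric] by (simp add: field_simps)
  moreover have "\<bar>\<sigma>\<bar> < 1" "s = R * \<sigma>"
    using sR R by (auto simp: \<sigma>_def)
  ultimately have \<sigma>: "\<bar>\<sigma>\<bar> < 1" "s = R * \<sigma>" "\<sigma> = 1 - 2 * z"
    by auto
  have z: "0 < z" "z < 1" using \<sigma>(1,3) by auto
  define f where "f = (\<lambda>\<tau>. ennreal ((\<tau>\<^sup>2 - 1) powr r * (1 / ((1 + A) * \<tau> - (1 - A) * \<sigma>)) ^ m))"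
  have [measurable]: "f \<in> borel_measurable borel" unfolding f_def by measurable
  have 1: "ennreal (if 0 < (- s + R * \<tau>) + 2 * s \<and> 1 < (- s + R * \<tau>) * ((- s + R * \<tau>) + 2 * s)
      then ((- s + R * \<tau>) * ((- s + R * \<tau>) + 2 * s) - 1) powr r * (1 / ((- s + R * \<tau>) + A * ((- s + R * \<tau>) + 2 * s))) ^ m else 0)
     = ennreal (1 / R ^ 3) * (f \<tau> * indicator {1<..} \<tau>)" for \<tau>
  proof -
    have Q: "(- s + R * \<tau>) * ((- s + R * \<tau>) + 2 * s) - 1 = R\<^sup>2 * (\<tau>\<^sup>2 - 1)"
      using R2 by algebra
    have k: "(- s + R * \<tau>) + A * ((- s + R * \<tau>) + 2 * s) = R * ((1 + A) * \<tau> - (1 - A) * \<sigma>)"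
      unfolding \<sigma>(2) by algebra
    have "0 < (- s + R * \<tau>) + 2 * s \<and> 1 < (- s + R * \<tau>) * ((- s + R * \<tau>) + 2 * s) \<longleftrightarrow> 0 < R * (\<sigma> + \<tau>) \<and> 0 < R\<^sup>2 * (\<tau>\<^sup>2 - 1)"
      unfolding Q[symmetric] by (auto simp: \<sigma>(2) algebra_simps)
    also have "\<dots> \<longleftrightarrow> 0 < \<sigma> + \<tau> \<and> 1 < \<bar>\<tau>\<bar>"
      using R abs_square_less_1[of \<tau>] power2_eq_1_iff[of \<tau>] by (auto simp: zero_less_mult_iff)
    \<comment> \<open>The sign condition selects one branch: as
      \<open>\<bar>\<sigma>\<bar> < 1\<close>, it excludes \<open>\<tau> < -1\<close> and holds
      whenever \<open>1 < \<tau>\<close>.\<close>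
    also have "\<dots> \<longleftrightarrow> 1 < \<tau>"
      using \<sigma>(1) by auto
    finally have c: "0 < (- s + R * \<tau>) + 2 * s \<and> 1 < (- s + R * \<tau>) * ((- s + R * \<tau>) + 2 * s) \<longleftrightarrow> 1 < \<tau>" .
    show ?thesis
    proof (cases "1 < \<tau>")
      case True
      then have "0 < \<tau>\<^sup>2 - 1" by simp
      then have "(R\<^sup>2 * (\<tau>\<^sup>2 - 1)) powr r * (1 / (R * ((1 + A) * \<tau> - (1 - A) * \<sigma>))) ^ m
        = 1 / R ^ 3 * ((\<tau>\<^sup>2 - 1) powr r * (1 / ((1 + A) * \<tau> - (1 - A) * \<sigma>)) ^ m)"
        using R by (subst powr_mult) (simp_all add: r_def square_powr_half power_divide power_mult_distrib)
      then show ?thesis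
        unfolding c Q k using True R by (simp add: f_def ennreal_mult'[symmetric])
    qed (simp only: c, simp)
  qed
  have 2: "f ((1 + t) / (1 - t)) * ennreal (2 / (1 - t)\<^sup>2)
      = ennreal (1 / 4) * ennreal (t powr r * (1 - t) * (1 / (z + A * (1 - z) + (1 - z + A * z) * t)) ^ m)"
    if t: "0 < t" "t < 1" for t
  proof -
    define D where "D = z + A * (1 - z) + (1 - z + A * z) * t"
    have D: "0 < D" unfolding D_def using A t z by (intro add_pos_pos mult_pos_pos) auto
    have k: "(1 + A) * ((1 + t) / (1 - t)) - (1 - A) * \<sigma> = 2 / (1 - t) * D"
      using t unfolding \<sigma>(3) D_def by (simp add: field_simps)
    have Q: "((1 + t) / (1 - t))\<^sup>2 - 1 = (2 / (1 - t))\<^sup>2 * t"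
    proof -
      have "((2 - y) / y)\<^sup>2 - 1 = (2 / y)\<^sup>2 * (1 - y)" if "0 < y" for y :: real
        using that by (simp add: field_simps power2_eq_square)
      from this[of "1 - t"] t show ?thesis by simp
    qed
    have X: "0 < 2 / (1 - t)" using t by simp
    have "((2 / (1 - t))\<^sup>2 * t) powr r * (1 / (2 / (1 - t) * D)) ^ m * (2 / (1 - t)\<^sup>2)
       = t powr r * (1 / D) ^ m * (1 / (2 / (1 - t)) ^ 3 * (2 / (1 - t)\<^sup>2))"
      unfolding power_mult_distrib[of _ _ m] power_one_over[of "2 / (1 - t) * D"] power_one_over[of D]
      using t X D by (subst powr_mult) (simp_all add: r_def square_powr_half)
    \<comment> \<open>Three inverse powers of \<open>2 / (1 - t)\<close> remain from the determinant
      and the rate; the derivative of the Cayley map leaves a single factor \<open>1 - t\<close>,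
      which later separates the two hypergeometric terms.\<close>
    also have "1 / (2 / (1 - t)) ^ 3 * (2 / (1 - t)\<^sup>2) = 1 / 4 * (1 - t)"
    proof -
      have "1 / (2 / y) ^ 3 * (2 / y\<^sup>2) = 1 / 4 * y" if "0 < y" for y :: real
        using that by (simp add: field_simps power2_eq_square power3_eq_cube)
      from this[of "1 - t"] t show ?thesis by simp
    qed
    finally have eq: "((2 / (1 - t))\<^sup>2 * t) powr r * (1 / (2 / (1 - t) * D)) ^ m * (2 / (1 - t)\<^sup>2)
       = t powr r * (1 / D) ^ m * (1 / 4 * (1 - t))" .
    show ?thesis
      unfolding f_def k Q D_def[symmetric]
      by (subst ennreal_mult''[symmetric], simp, subst ennreal_mult'[symmetric], simp, simp only: eq, simp only: mult_ac)
  qed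
  have "(\<integral>\<^sup>+y. ennreal (if 0 < y + 2 * s \<and> 1 < y * (y + 2 * s)
      then (y * (y + 2 * s) - 1) powr r * (1 / (y + A * (y + 2 * s))) ^ m else 0) \<partial>lborel)
    = ennreal R * (\<integral>\<^sup>+\<tau>. ennreal (1 / R ^ 3) * (f \<tau> * indicator {1<..} \<tau>) \<partial>lborel)"
    using R by (subst nn_integral_real_affine[where c = R and t = "- s"]) (simp_all only: 1, auto)
  also have "\<dots> = ennreal R * (ennreal (1 / R ^ 3) * (\<integral>\<^sup>+\<tau>\<in>{1<..}. f \<tau> \<partial>lborel))"
    by (subst nn_integral_cmult) auto
  also have "(\<integral>\<^sup>+\<tau>\<in>{1<..}. f \<tau> \<partial>lborel)
     = (\<integral>\<^sup>+t\<in>{0<..<1}. f ((1 + t) / (1 - t)) * ennreal (2 / (1 - t)\<^sup>2) \<partial>lborel)"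
    by (rule nn_integral_cayley) measurable
  also have "\<dots> = (\<integral>\<^sup>+t. ennreal (1 / 4) * (ennreal (t powr r * (1 - t) * (1 / (z + A * (1 - z) + (1 - z + A * z) * t)) ^ m)
       * indicator {0<..<1} t) \<partial>lborel)"
    by (intro nn_integral_cong) (auto simp: 2 mult.assoc split: split_indicator)
  also have "\<dots> = ennreal (1 / 4) * euler_type_integral m A z"
    unfolding euler_type_integral_def r_def by (subst nn_integral_cmult) auto
  also have "ennreal R * (ennreal (1 / R ^ 3) * (ennreal (1 / 4) * euler_type_integral m A z))
     = ennreal (R * (1 / R ^ 3 * (1 / 4))) * euler_type_integral m A z"
    using R by (simp only: ennreal_mult'[symmetric] mult.assoc[symmetric]) (simp add: ennreal_mult'[symmetric])
  \<comment> \<open>The three inverse powers of \<open>R\<close> and the Jacobian \<open>R\<close>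
    leave the Cauchy weight in \<open>s\<close>, ready for the cosine substitution.\<close>
  also have "R * (1 / R ^ 3 * (1 / 4)) = 1 / (4 * (1 + s\<^sup>2))"
    unfolding R2[symmetric] using R by (simp add: power2_eq_square power3_eq_cube)
  finally show ?thesis unfolding r_def .
qed


text \<open>
  The squared first coordinate of a unit eigenvector for the smallest eigenvalue; on scalar matrices
  the quotient is \<open>0 / 0\<close> and the value is meaningless.
\<close>

definition angle_of :: "real \<times> real \<times> real \<Rightarrow> real" where
  "angle_of w = (case w of (a, b, c) \<Rightarrow> (1 - (a - c) / sqrt ((a - c)\<^sup>2 + 4 * b\<^sup>2)) / 2)"

lemma angle_of_measurable [measurable]: "angle_of \<in> borel_measurable borel"
  unfolding angle_of_def[abs_def] borel_prod[symmetric] by measurable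

text \<open>In the new coordinates all three entries are \<open>b\<close> times functions of
  \<open>s\<close> and \<open>y\<close>. Hence the angle and the support do not see
  \<open>b\<close>, the determinant contributes \<open>b ^ m / b ^ 3\<close>, and the Jacobian
  \<open>2 * b * b\<close> raises this to \<open>b ^ (m - 1)\<close>, against an exponential with
  rate \<open>k s y / 2\<close>.\<close>

lemma nn_integral_wishart_density_angle:
  assumes A: "0 < A" and m: "2 \<le> m" and h [measurable]: "h \<in> borel_measurable borel"
  shows "(\<integral>\<^sup>+w. h (angle_of w) * ennreal (wishart_density m A w) \<partial>lborel)
    = (\<integral>\<^sup>+z\<in>{0<..<1}. h z * (ennreal (2 ^ m * (real m - 1) * A powr (real m / 2) / (4 * pi) / sqrt (z * (1 - z)))
        * euler_type_integral m A z) \<partial>lborel)"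
proof -
  define K where "K = A powr (real m / 2) / (4 * pi * fact (m - 2))"
  have K: "0 \<le> K" by (simp add: K_def)
  define r where "r = (real m - 3) / 2"
  define \<zeta> where "\<zeta> = (\<lambda>s::real. (1 - s / sqrt (1 + s\<^sup>2)) / 2)"
  have [measurable]: "\<zeta> \<in> borel_measurable borel" unfolding \<zeta>_def by measurable
  define \<Phi> where "\<Phi> = (\<lambda>w. h (angle_of w) * ennreal (wishart_density m A w))"
  have [measurable]: "\<Phi> \<in> borel_measurable borel" unfolding \<Phi>_def by measurable
  define Q where "Q = (\<lambda>s y::real. if 0 < y + 2 * s \<and> 1 < y * (y + 2 * s) then (y * (y + 2 * s) - 1) powr r else 0)"
  have [measurable]: "case_prod Q \<in> borel_measurable (borel \<Otimes>\<^sub>M borel)" unfolding Q_def by measurable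
  define k where "k = (\<lambda>s y. y + A * (y + 2 * s))"
  have [measurable]: "case_prod k \<in> borel_measurable (borel \<Otimes>\<^sub>M borel)" unfolding k_def by measurable
  define E where "E = (\<lambda>s y b. ennreal (b ^ (m - 1) * exp (- (b * k s y) / 2)) * indicator {0<..} (b::real))"
  have [measurable]: "(\<lambda>(s, y, b). E s y b) \<in> borel_measurable (borel \<Otimes>\<^sub>M borel \<Otimes>\<^sub>M borel)"
    unfolding E_def k_def by measurable
  define X where "X = (\<lambda>s y b. ennreal (2 * K) * h (\<zeta> s) * ennreal (Q s y) * E s y b)"
  have [measurable]: "(\<lambda>(s, y, b). X s y b) \<in> borel_measurable (borel \<Otimes>\<^sub>M borel \<Otimes>\<^sub>M borel)"
    unfolding X_def E_def k_def by measurable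
  have [measurable (raw)]: "(\<lambda>x. X (s x) (y x) (b x)) \<in> borel_measurable M"
    if [measurable]: "s \<in> borel_measurable M" "y \<in> borel_measurable M" "b \<in> borel_measurable M"
    for M :: "'x measure" and s y b
  proof -
    have "(\<lambda>x. (\<lambda>(s, y, b). X s y b) (s x, y x, b x)) \<in> borel_measurable M" by measurable
    then show ?thesis by simp
  qed
  have X: "ennreal (2 * b * b) * \<Phi> (b * y + 2 * b * s, b, b * y) = X s y b" if b: "0 < b" for b s y
  proof -
    have a: "angle_of (b * y + 2 * b * s, b, b * y) = \<zeta> s"
    proof -
      have "sqrt ((2 * b * s)\<^sup>2 + 4 * b\<^sup>2) = sqrt ((2 * b)\<^sup>2 * (1 + s\<^sup>2))"
        by (rule arg_cong[of _ _ sqrt]) algebra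
      also have "\<dots> = 2 * b * sqrt (1 + s\<^sup>2)"
        unfolding real_sqrt_mult[of "(2 * b)\<^sup>2"] real_sqrt_abs using b by simp
      finally show ?thesis using b by (simp add: angle_of_def \<zeta>_def)
    qed
    have c: "0 < b * y + 2 * b * s \<and> b\<^sup>2 < (b * y + 2 * b * s) * (b * y) \<longleftrightarrow> 0 < y + 2 * s \<and> 1 < y * (y + 2 * s)"
    proof -
      have 1: "b * y + 2 * b * s = b * (y + 2 * s)" by algebra
      have 2: "(b * y + 2 * b * s) * (b * y) = b\<^sup>2 * (y * (y + 2 * s))" by algebra
      show ?thesis
        unfolding 2 unfolding 1 using b by (auto simp: zero_less_mult_iff)
    qed
    have d: "(b * y + 2 * b * s) * (b * y) - b\<^sup>2 = b\<^sup>2 * (y * (y + 2 * s) - 1)" by algebra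
    have e: "- (A * (b * y + 2 * b * s) + b * y) / 2 = - (b * k s y) / 2"
      unfolding k_def by (simp add: algebra_simps)
    have p: "b * b * (b ^ m / b ^ 3) = b ^ (m - 1)"
      using b m by (cases m) (auto simp: power3_eq_cube)
    have W: "wishart_density m A (b * y + 2 * b * s, b, b * y)
       = K * (b\<^sup>2 * (y * (y + 2 * s) - 1)) powr r * exp (- (b * k s y) / 2)
         * (if 0 < y + 2 * s \<and> 1 < y * (y + 2 * s) then 1 else 0)"
      by (simp only: wishart_density_def prod.case c d e K_def r_def)
    also have "\<dots> = K * (b ^ m / b ^ 3) * exp (- (b * k s y) / 2) * Q s y"
    proof (cases "0 < y + 2 * s \<and> 1 < y * (y + 2 * s)")
      case True
      then have "(b\<^sup>2 * (y * (y + 2 * s) - 1)) powr r = b ^ m / b ^ 3 * (y * (y + 2 * s) - 1) powr r"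
        using b by (subst powr_mult) (simp_all add: r_def square_powr_half)
      with True show ?thesis by (simp add: Q_def)
    next
      case False
      then show ?thesis by (simp only: Q_def if_False mult_zero_right)
    qed
    finally have W: "2 * b * b * wishart_density m A (b * y + 2 * b * s, b, b * y)
       = 2 * K * (Q s y * (b ^ (m - 1) * exp (- (b * k s y) / 2)))"
      unfolding p[symmetric] by (simp only: mult_ac)
    have Q0: "0 \<le> Q s y" by (simp add: Q_def)
    have "ennreal (2 * b * b) * ennreal (wishart_density m A (b * y + 2 * b * s, b, b * y))
       = ennreal (2 * K) * (ennreal (Q s y) * ennreal (b ^ (m - 1) * exp (- (b * k s y) / 2)))"
      using b K Q0 by (simp only: ennreal_mult'[symmetric] W mult_nonneg_nonneg less_imp_le zero_le_numeral)
    then show ?thesis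
      using b unfolding X_def E_def \<Phi>_def a by (simp add: mult_ac)
  qed
  have IE: "(\<integral>\<^sup>+b. X s y b \<partial>lborel)
      = ennreal (2 * K * fact (m - 1) * 2 ^ m) * h (\<zeta> s) *
        ennreal (if 0 < y + 2 * s \<and> 1 < y * (y + 2 * s)
          then (y * (y + 2 * s) - 1) powr r * (1 / (y + A * (y + 2 * s))) ^ m else 0)" for s y
  proof (cases "0 < y + 2 * s \<and> 1 < y * (y + 2 * s)")
    case True
    \<comment> \<open>The product exceeds 1 and one factor is positive, so \<open>y\<close> is
      positive too. This makes the rate \<open>k s y\<close> positive and the Gamma integral
      finite.\<close>
    then have "0 < y * (y + 2 * s)" by linarith
    with True have "0 < y" by (simp add: zero_less_mult_iff)
    then have k: "0 < k s y" using True A by (simp add: k_def add_pos_pos)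
    have "(\<integral>\<^sup>+b. X s y b \<partial>lborel) = ennreal (2 * K) * h (\<zeta> s) * ennreal (Q s y) * ennreal (fact (m - 1) * (2 / k s y) ^ m)"
      unfolding X_def E_def using nn_integral_power_times_exp_scaled[OF k, of "m - 1"] m
      by (subst nn_integral_cmult) auto
    also have "\<dots> = h (\<zeta> s) * (ennreal (2 * K) * (ennreal (Q s y) * ennreal (fact (m - 1) * (2 / k s y) ^ m)))"
      by (simp only: mult_ac)
    also have "ennreal (2 * K) * (ennreal (Q s y) * ennreal (fact (m - 1) * (2 / k s y) ^ m))
      = ennreal (2 * K * (Q s y * (fact (m - 1) * (2 / k s y) ^ m)))"
      using K by (simp add: ennreal_mult'[symmetric] Q_def)
    also have "2 * K * (Q s y * (fact (m - 1) * (2 / k s y) ^ m))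
      = 2 * K * fact (m - 1) * 2 ^ m * (Q s y * (1 / k s y) ^ m)"
      by (simp add: power_divide)
    also have "ennreal \<dots> = ennreal (2 * K * fact (m - 1) * 2 ^ m) * ennreal (Q s y * (1 / k s y) ^ m)"
      using K by (intro ennreal_mult') simp
    finally show ?thesis
      using True by (simp add: Q_def k_def mult_ac)
  next
    case False
    then show ?thesis
      by (simp only: X_def Q_def if_False ennreal_0 mult_zero_right mult_zero_left nn_integral_const)
  qed
  \<comment> \<open>Replacing the second basis vector by its negative flips only \<open>b\<close>,
    so the half-line of positive \<open>b\<close> suffices.\<close>
  have sym: "\<Phi> (a, - b, c) = \<Phi> (a, b, c)" for a b c
    by (simp add: \<Phi>_def angle_of_def wishart_density_def)
  have "(\<integral>\<^sup>+w. \<Phi> w \<partial>lborel) = (\<integral>\<^sup>+a. \<integral>\<^sup>+b. \<integral>\<^sup>+c. \<Phi> (a, b, c) \<partial>lborel \<partial>lborel \<partial>lborel)"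
    by (subst nn_integral_lborel_pair, measurable, subst nn_integral_lborel_pair, measurable)
  \<comment> \<open>\<open>b\<close> goes outermost because it serves as the constant scale of the
    affine substitutions in \<open>a\<close> and \<open>c\<close>.\<close>
  also have "\<dots> = (\<integral>\<^sup>+b. \<integral>\<^sup>+a. \<integral>\<^sup>+c. \<Phi> (a, b, c) \<partial>lborel \<partial>lborel \<partial>lborel)"
    by (rule lborel_pair.Fubini') measurable
  also have "\<dots> = (\<integral>\<^sup>+b. \<integral>\<^sup>+c. \<integral>\<^sup>+a. \<Phi> (a, b, c) \<partial>lborel \<partial>lborel \<partial>lborel)"
    by (intro nn_integral_cong lborel_pair.Fubini') measurable
  also have "\<dots> = 2 * (\<integral>\<^sup>+b\<in>{0<..}. (\<integral>\<^sup>+c. \<integral>\<^sup>+a. \<Phi> (a, b, c) \<partial>lborel \<partial>lborel) \<partial>lborel)"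
    by (rule nn_integral_even) (auto simp: sym)
  also have "(\<integral>\<^sup>+b\<in>{0<..}. (\<integral>\<^sup>+c. \<integral>\<^sup>+a. \<Phi> (a, b, c) \<partial>lborel \<partial>lborel) \<partial>lborel)
     = (\<integral>\<^sup>+b. \<integral>\<^sup>+s. \<integral>\<^sup>+y. X s y b \<partial>lborel \<partial>lborel \<partial>lborel)"
  proof (intro nn_integral_cong)
    fix b :: real
    show "(\<integral>\<^sup>+c. \<integral>\<^sup>+a. \<Phi> (a, b, c) \<partial>lborel \<partial>lborel) * indicator {0<..} b = (\<integral>\<^sup>+s. \<integral>\<^sup>+y. X s y b \<partial>lborel \<partial>lborel)"
    proof (cases "0 < b")
      case True
      have "(\<integral>\<^sup>+c. \<integral>\<^sup>+a. \<Phi> (a, b, c) \<partial>lborel \<partial>lborel)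
        = (\<integral>\<^sup>+c. \<integral>\<^sup>+s. ennreal (2 * b) * \<Phi> (c + 2 * b * s, b, c) \<partial>lborel \<partial>lborel)"
      proof (rule nn_integral_cong)
        fix c
        show "(\<integral>\<^sup>+a. \<Phi> (a, b, c) \<partial>lborel) = (\<integral>\<^sup>+s. ennreal (2 * b) * \<Phi> (c + 2 * b * s, b, c) \<partial>lborel)"
          using True by (subst nn_integral_real_affine[where c = "2 * b" and t = c]) (auto simp: nn_integral_cmult)
      qed
      also have "\<dots> = (\<integral>\<^sup>+s. \<integral>\<^sup>+c. ennreal (2 * b) * \<Phi> (c + 2 * b * s, b, c) \<partial>lborel \<partial>lborel)"
        by (rule lborel_pair.Fubini') measurable
      also have "\<dots> = (\<integral>\<^sup>+s. \<integral>\<^sup>+y. X s y b \<partial>lborel \<partial>lborel)"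
      proof (rule nn_integral_cong)
        fix s
        have "(\<integral>\<^sup>+c. ennreal (2 * b) * \<Phi> (c + 2 * b * s, b, c) \<partial>lborel)
          = ennreal b * (\<integral>\<^sup>+y. ennreal (2 * b) * \<Phi> (b * y + 2 * b * s, b, b * y) \<partial>lborel)"
          using True by (subst nn_integral_real_affine[where c = b and t = 0]) auto
        also have "\<dots> = (\<integral>\<^sup>+y. ennreal (2 * b * b) * \<Phi> (b * y + 2 * b * s, b, b * y) \<partial>lborel)"
        proof -
          have "ennreal (2 * b * b) = ennreal b * ennreal (2 * b)"
            using True by (subst ennreal_mult'[symmetric]) (simp_all add: mult_ac)
          then show ?thesis
            by (simp add: mult.assoc nn_integral_cmult)
        qed
        finally show "(\<integral>\<^sup>+c. ennreal (2 * b) * \<Phi> (c + 2 * b * s, b, c) \<partial>lborel) = (\<integral>\<^sup>+y. X s y b \<partial>lborel)"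
          by (simp only: X[OF True])
      qed
      finally show ?thesis using True by simp
    qed (simp add: X_def E_def)
  qed
  also have "\<dots> = (\<integral>\<^sup>+s. \<integral>\<^sup>+b. \<integral>\<^sup>+y. X s y b \<partial>lborel \<partial>lborel \<partial>lborel)"
    by (rule lborel_pair.Fubini') measurable
  also have "\<dots> = (\<integral>\<^sup>+s. \<integral>\<^sup>+y. \<integral>\<^sup>+b. X s y b \<partial>lborel \<partial>lborel \<partial>lborel)"
    by (intro nn_integral_cong lborel_pair.Fubini') measurable
  also have "\<dots> = (\<integral>\<^sup>+s. ennreal (2 * K * fact (m - 1) * 2 ^ m) * h (\<zeta> s) *
       (ennreal (1 / (4 * (1 + s\<^sup>2))) * euler_type_integral m A (\<zeta> s)) \<partial>lborel)"
    unfolding IE by (intro nn_integral_cong, subst nn_integral_cmult, measurable)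
      (simp only: nn_integral_hyperbola[OF A] r_def \<zeta>_def)
  also have "2 * \<dots> = (\<integral>\<^sup>+s. 2 * (ennreal (2 * K * fact (m - 1) * 2 ^ m) * h (\<zeta> s) *
       (ennreal (1 / (4 * (1 + s\<^sup>2))) * euler_type_integral m A (\<zeta> s))) \<partial>lborel)"
    by (rule nn_integral_cmult[symmetric]) measurable
  also have "\<dots> = (\<integral>\<^sup>+s. (ennreal (K * fact (m - 1) * 2 ^ m) * h (\<zeta> s) * euler_type_integral m A (\<zeta> s)) *
       ennreal (1 / (1 + s\<^sup>2)) \<partial>lborel)"
  proof (intro nn_integral_cong)
    fix s :: real
    have "2 * (ennreal (2 * K * fact (m - 1) * 2 ^ m) * ennreal (1 / (4 * (1 + s\<^sup>2))))
      = ennreal (2 * (2 * K * fact (m - 1) * 2 ^ m * (1 / (4 * (1 + s\<^sup>2)))))"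
      using K by (subst ennreal_mult'[of 2], simp, subst ennreal_mult'[of "2 * K * fact (m - 1) * 2 ^ m"]) simp_all
    \<comment> \<open>The 2 for the sign of \<open>b\<close>, the 2 of the Jacobian and the
      \<open>1 / 4\<close> of the hyperbola integral cancel.\<close>
    also have "2 * (2 * K * fact (m - 1) * 2 ^ m * (1 / (4 * (1 + s\<^sup>2)))) = K * fact (m - 1) * 2 ^ m * (1 / (1 + s\<^sup>2))"
    proof -
      have "2 * (2 * x * (1 / (4 * y))) = x * (1 / y)" for x y :: real
        by simp
      from this[of "K * fact (m - 1) * 2 ^ m"] show ?thesis
        by (simp only: mult.assoc)
    qed
    also have "ennreal \<dots> = ennreal (K * fact (m - 1) * 2 ^ m) * ennreal (1 / (1 + s\<^sup>2))"
      using K by (intro ennreal_mult') simp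
    finally have e: "2 * (ennreal (2 * K * fact (m - 1) * 2 ^ m) * ennreal (1 / (4 * (1 + s\<^sup>2))))
      = ennreal (K * fact (m - 1) * 2 ^ m) * ennreal (1 / (1 + s\<^sup>2))" .
    have "2 * (ennreal (2 * K * fact (m - 1) * 2 ^ m) * h (\<zeta> s) *
       (ennreal (1 / (4 * (1 + s\<^sup>2))) * euler_type_integral m A (\<zeta> s)))
      = 2 * (ennreal (2 * K * fact (m - 1) * 2 ^ m) * ennreal (1 / (4 * (1 + s\<^sup>2)))) * (h (\<zeta> s) * euler_type_integral m A (\<zeta> s))"
      by (simp only: mult_ac)
    also have "\<dots> = (ennreal (K * fact (m - 1) * 2 ^ m) * h (\<zeta> s) * euler_type_integral m A (\<zeta> s)) *
       ennreal (1 / (1 + s\<^sup>2))"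
      unfolding e by (simp only: mult_ac)
    finally show "2 * (ennreal (2 * K * fact (m - 1) * 2 ^ m) * h (\<zeta> s) *
       (ennreal (1 / (4 * (1 + s\<^sup>2))) * euler_type_integral m A (\<zeta> s)))
      = (ennreal (K * fact (m - 1) * 2 ^ m) * h (\<zeta> s) * euler_type_integral m A (\<zeta> s)) *
       ennreal (1 / (1 + s\<^sup>2))" .
  qed
  also have "\<dots> = (\<integral>\<^sup>+z\<in>{0<..<1}. ennreal (K * fact (m - 1) * 2 ^ m) * h (\<zeta> (- ((2 * z - 1) / (2 * sqrt (z * (1 - z))))))
       * euler_type_integral m A (\<zeta> (- ((2 * z - 1) / (2 * sqrt (z * (1 - z)))))) * ennreal (1 / sqrt (z * (1 - z))) \<partial>lborel)"
    by (rule nn_integral_cosine_substitution) measurable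
  also have "\<dots> = (\<integral>\<^sup>+z\<in>{0<..<1}. h z * (ennreal (2 ^ m * (real m - 1) * A powr (real m / 2) / (4 * pi) / sqrt (z * (1 - z)))
        * euler_type_integral m A z) \<partial>lborel)"
  proof (intro nn_integral_cong)
    fix z :: real
    show "ennreal (K * fact (m - 1) * 2 ^ m) * h (\<zeta> (- ((2 * z - 1) / (2 * sqrt (z * (1 - z))))))
       * euler_type_integral m A (\<zeta> (- ((2 * z - 1) / (2 * sqrt (z * (1 - z)))))) * ennreal (1 / sqrt (z * (1 - z))) * indicator {0<..<1} z
      = h z * (ennreal (2 ^ m * (real m - 1) * A powr (real m / 2) / (4 * pi) / sqrt (z * (1 - z)))
        * euler_type_integral m A z) * indicator {0<..<1} z"
    proof (cases "z \<in> {0<..<1}")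
      case True
      then have z: "\<zeta> (- ((2 * z - 1) / (2 * sqrt (z * (1 - z))))) = z"
        unfolding \<zeta>_def using cosine_substitution_inverse[of z] by simp
      have "fact (m - 1) = (real m - 1) * (fact (m - 2) :: real)"
        using m by (cases "m - 1") (auto simp: fact_Suc numeral_2_eq_2 diff_Suc split: nat.splits)
      moreover have "x / (4 * pi * u) * (n * u) * y * (1 / v) = y * n * x / (4 * pi) / v"
        if "u \<noteq> 0" for x u n y v :: real
        using that by simp
      ultimately have "K * fact (m - 1) * 2 ^ m * (1 / sqrt (z * (1 - z)))
        = 2 ^ m * (real m - 1) * A powr (real m / 2) / (4 * pi) / sqrt (z * (1 - z))"
        by (simp only: K_def fact_nonzero not_False_eq_True)
      then have e: "ennreal (K * fact (m - 1) * 2 ^ m) * ennreal (1 / sqrt (z * (1 - z)))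
        = ennreal (2 ^ m * (real m - 1) * A powr (real m / 2) / (4 * pi) / sqrt (z * (1 - z)))"
        using K by (subst ennreal_mult'[symmetric]) (simp, simp only:)
      show ?thesis
        unfolding z e[symmetric] by (simp only: mult_ac)
    qed simp
  qed
  finally show ?thesis unfolding \<Phi>_def .
qed

section \<open>Gauss hypergeometric functions as Euler integrals\<close>

lemma has_bochner_integral_powr_Ioo:
  fixes r :: real
  assumes r: "-1 < r"
  shows "has_bochner_integral lborel (\<lambda>t. indicator {0<..<1} t * t powr r) (1 / (r + 1))"
proof (rule has_bochner_integral_nn_integral)
  have "(\<integral>\<^sup>+t. ennreal (indicator {0<..<1} t * t powr r) \<partial>lborel)
      = (\<integral>\<^sup>+t. ennreal (if t \<in> {0..1} then t powr r else 0) \<partial>lborel)"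
    by (intro nn_integral_cong_AE, use AE_lborel_singleton[of 0] AE_lborel_singleton[of 1] in eventually_elim)
       (auto split: split_indicator)
  also have "\<dots> = ennreal (1 / (r + 1))"
    using has_integral_powr_from_0[OF r, of 1]
    by (intro nn_integral_has_integral_lborel) (simp_all only: has_integral_restrict_UNIV, auto)
  finally show "(\<integral>\<^sup>+t. ennreal (indicator {0<..<1} t * t powr r) \<partial>lborel) = ennreal (1 / (r + 1))" .
qed (use r in auto)

lemma integrable_euler_integrand:
  fixes a b c :: real
  assumes a: "0 \<le> a" and b: "0 < b" and c: "0 < c"
  shows "integrable lborel (\<lambda>t. indicator {0<..<1} t * (t powr (b - 1) * (1 + c * t) powr (- a)))"
proof (rule Bochner_Integration.integrable_bound)
  show "integrable lborel (\<lambda>t::real. indicator {0<..<1} t * t powr (b - 1))"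
    using has_bochner_integral_powr_Ioo[of "b - 1"] b by (auto intro: integrable.intros)
  have "(1 + c * t) powr (- a) \<le> 1" if "0 < t" for t
    using that a c by (simp add: powr_minus inverse_le_1_iff ge_one_powr_ge_zero)
  then show "AE t in lborel. norm (indicator {0<..<1} t * (t powr (b - 1) * (1 + c * t) powr (- a)))
      \<le> norm (indicator {0<..<1} t * t powr (b - 1))"
    by (auto simp: mult_left_le split: split_indicator)
qed measurable

text \<open>Both products share all but their end factors. With lower parameter \<open>b + 1\<close>
  the Gauss coefficients thus acquire \<open>b / (b + n)\<close>, which is \<open>b\<close> times
  the integral of \<open>t powr (b + n - 1)\<close> over the unit interval.\<close>

lemma pochhammer_ratio_succ:
  fixes b :: real
  assumes "0 < b"
  shows "pochhammer b n / pochhammer (b + 1) n = b / (b + real n)"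
proof -
  have "b * pochhammer (b + 1) n = pochhammer b n * (b + real n)"
    by (metis pochhammer_rec pochhammer_Suc)
  moreover have "pochhammer (b + 1) n > 0"
    using assms by (intro pochhammer_pos) simp
  ultimately show ?thesis
    using assms by (simp add: frac_eq_eq mult_ac)
qed

text \<open>Expand the power of \<open>1 + c * t\<close> by the binomial series and integrate
  termwise. For \<open>c < 1\<close> the coefficients \<open>k n\<close> are absolutely summable and
  dominate the whole series uniformly up to the integrable factor
  \<open>t powr (b - 1)\<close>.\<close>

lemma euler_integral_series:
  fixes a b c :: real
  assumes b: "0 < b" and c: "0 < c" "c < 1"
  shows "(\<lambda>n. (- a gchoose n) * c ^ n * (1 / (b + real n))) sums
    (LINT t|lborel. indicator {0<..<1} t * (t powr (b - 1) * (1 + c * t) powr (- a)))"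
proof -
  define k where "k = (\<lambda>n. (- a gchoose n) * c ^ n)"
  define f where "f = (\<lambda>n t. k n * (indicator {0<..<1} t * t powr (b + real n - 1)))"
  have k: "summable (\<lambda>n. \<bar>k n\<bar>)"
  proof -
    \<comment> \<open>Convergence at the midpoint between \<open>c\<close> and 1 yields absolute
      convergence at \<open>c\<close>.\<close>
    have "summable (\<lambda>n. (- a gchoose n) * ((1 + c) / 2) ^ n)"
      using gen_binomial_real[of "(1 + c) / 2" "- a"] c by (auto simp: sums_iff)
    from powser_insidea[OF this, of c] show ?thesis
      using c by (simp add: k_def)
  qed
  have bf: "has_bochner_integral lborel (f n) (k n * (1 / (b + real n)))" for n
    unfolding f_def using has_bochner_integral_powr_Ioo[of "b + real n - 1"] b
    by (intro has_bochner_integral_mult_right) auto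
  have ft: "f n t = indicator {0<..<1} t * t powr (b - 1) * ((- a gchoose n) * (c * t) ^ n)" for n t
    by (auto simp: f_def k_def powr_add powr_diff powr_realpow power_mult_distrib split: split_indicator)
  have "(\<lambda>n. integral\<^sup>L lborel (f n)) sums (LINT t|lborel. (\<Sum>n. f n t))"
  proof (rule sums_integral)
    show "integrable lborel (f n)" for n
      using bf by (rule integrable.intros)
    show "AE t in lborel. summable (\<lambda>n. norm (f n t))"
    proof (intro AE_I2)
      fix t :: real
      show "summable (\<lambda>n. norm (f n t))"
      proof (cases "t \<in> {0<..<1}")
        case True
        have "norm (f n t) \<le> t powr (b - 1) * \<bar>k n\<bar>" for n
        proof -
          have "norm (f n t) = t powr (b - 1) * \<bar>k n\<bar> * t ^ n"
            using True unfolding ft by (simp add: k_def abs_mult power_mult_distrib)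
          also have "\<dots> \<le> t powr (b - 1) * \<bar>k n\<bar> * 1"
            using True by (intro mult_left_mono power_le_one) auto
          finally show ?thesis by simp
        qed
        then show ?thesis
          by (intro summable_comparison_test'[OF summable_mult[OF k]]) auto
      qed (simp add: f_def)
    qed
    show "summable (\<lambda>n. LINT t|lborel. norm (f n t))"
    proof (rule summable_comparison_test'[where N = 0])
      show "summable (\<lambda>n. \<bar>k n\<bar> * (1 / b))"
        by (intro summable_mult2 k)
      fix n
      have "(LINT t|lborel. norm (f n t)) = (LINT t|lborel. \<bar>k n\<bar> * (indicator {0<..<1} t * t powr (b + real n - 1)))"
        by (intro Bochner_Integration.integral_cong) (auto simp: f_def abs_mult)
      also have "\<dots> = \<bar>k n\<bar> * (1 / (b + real n))"
        using has_bochner_integral_powr_Ioo[of "b + real n - 1"] b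
        by (simp add: has_bochner_integral_integral_eq)
      also have "\<dots> \<le> \<bar>k n\<bar> * (1 / b)"
        using b by (intro mult_left_mono divide_left_mono) auto
      finally show "norm (LINT t|lborel. norm (f n t)) \<le> \<bar>k n\<bar> * (1 / b)"
        by simp
    qed
  qed
  moreover have "(\<Sum>n. f n t) = indicator {0<..<1} t * (t powr (b - 1) * (1 + c * t) powr (- a))" for t
  proof (cases "t \<in> {0<..<1}")
    case True
    then have "\<bar>c * t\<bar> < 1"
      using c mult_strict_mono[of c 1 t 1] by (simp add: abs_mult)
    from sums_mult[OF gen_binomial_real[OF this, of "- a"], of "t powr (b - 1)"] True show ?thesis
      unfolding ft by (simp add: sums_iff)
  qed (simp add: f_def)
  moreover have "integral\<^sup>L lborel (f n) = (- a gchoose n) * c ^ n * (1 / (b + real n))" for n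
    using has_bochner_integral_integral_eq[OF bf[of n]] by (simp only: k_def)
  ultimately show ?thesis
    by (simp only:)
qed

text \<open>One integral formula for both branches of \<open>hyp2F1\<close>. For
  \<open>c < 1\<close> the Gauss series matches the termwise integrated one; otherwise Euler's
  integral is the definition, and its Gamma quotient reduces to \<open>b\<close>.\<close>

lemma hyp2F1_succ_eq_euler_integral:
  fixes a b c :: real
  assumes b: "0 < b" and c: "0 < c"
  shows "hyp2F1 a b (b + 1) (- c)
    = b * (LINT t|lborel. indicator {0<..<1} t * (t powr (b - 1) * (1 + c * t) powr (- a)))"
proof (cases "c < 1")
  case True
  have "(\<lambda>n. b * ((- a gchoose n) * c ^ n * (1 / (b + real n)))) sums
     (b * (LINT t|lborel. indicator {0<..<1} t * (t powr (b - 1) * (1 + c * t) powr (- a))))"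
    by (intro sums_mult euler_integral_series b c True)
  moreover have "b * ((- a gchoose n) * c ^ n * (1 / (b + real n)))
     = fps_nth (fps_hypergeo [a, b] [b + 1] 1) n * (- c) ^ n" for n
  proof -
    have "fps_nth (fps_hypergeo [a, b] [b + 1] 1) n * (- c) ^ n
       = (pochhammer b n / pochhammer (b + 1) n) * (pochhammer a n / fact n) * (- c) ^ n"
      by simp
    also have "\<dots> = b / (b + real n) * (pochhammer a n / fact n) * ((- 1) ^ n * c ^ n)"
      unfolding pochhammer_ratio_succ[OF b] by (simp add: power_minus[of c])
    also have "\<dots> = b * ((- a gchoose n) * c ^ n * (1 / (b + real n)))"
      by (simp add: gbinomial_pochhammer mult_ac)
    finally show ?thesis ..
  qed
  ultimately show ?thesis
    using True c by (simp add: hyp2F1_def eval_fps_def sums_iff)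
next
  case False
  have "b \<notin> \<int>\<^sub>\<le>\<^sub>0"
    using b by (auto elim!: nonpos_Ints_cases)
  then have "Gamma (b + 1) / (Gamma b * Gamma (b + 1 - b)) = b"
    using b by (simp add: Gamma_plus1 Gamma_eq_zero_iff)
  \<comment> \<open>On the open interval \<open>1 - t\<close> is nonzero, so its power with exponent
    0 is 1.\<close>
  moreover have "(LBINT t:{0<..<1}. t powr (b - 1) * (1 - t) powr (b + 1 - b - 1) * (1 - - c * t) powr (- a))
     = (LINT t|lborel. indicator {0<..<1} t * (t powr (b - 1) * (1 + c * t) powr (- a)))"
    unfolding set_lebesgue_integral_def
    by (intro Bochner_Integration.integral_cong) (auto split: split_indicator)
  ultimately show ?thesis
    using False c unfolding hyp2F1_def by simp
qed

text \<open>Pulling \<open>B\<close> out of \<open>B + C * t\<close> leaves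
  \<open>1 + (C / B) * t\<close>, and the factor \<open>1 - t\<close> splits the integral into Euler
  integrals with parameters \<open>b1\<close> and \<open>b1 + 1\<close>. As these are half of
  \<open>m - 1\<close> and of \<open>m + 1\<close>, the quotients in front of the
  \<open>hyp2F1\<close> terms become \<open>1 / 2\<close>, whence the leading 2.\<close>

lemma euler_type_integral_eq_hyp2F1:
  fixes A z :: real
  assumes m: "2 \<le> m" and A: "0 < A" and z: "0 < z" "z < 1"
  defines "B \<equiv> z + A * (1 - z)" and "C \<equiv> 1 - z + A * z"
  shows "euler_type_integral m A z = ennreal (2 * (1 / B) ^ m *
    (1 / (real m - 1) * hyp2F1 (real m) ((real m - 1) / 2) ((real m + 1) / 2) (- (C / B))
   - 1 / (real m + 1) * hyp2F1 (real m) ((real m + 1) / 2) ((real m + 3) / 2) (- (C / B))))"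
proof -
  have B: "0 < B" unfolding B_def using A z by (intro add_pos_pos mult_pos_pos) auto
  have C: "0 < C" unfolding C_def using A z by (intro add_pos_pos mult_pos_pos) auto
  define c where "c = C / B"
  have c: "0 < c" using B C by (simp add: c_def)
  define I where "I = (\<lambda>b t. indicator {0<..<1} t * (t powr (b - 1) * (1 + c * t) powr (- real m)))"
  define b1 b2 where "b1 = (real m - 1) / 2" and "b2 = (real m + 1) / 2"
  have b: "0 < b1" "0 < b2" "b1 + 1 = b2" "b2 + 1 = (real m + 3) / 2" "b1 - 1 = (real m - 3) / 2"
    using m by (auto simp: b1_def b2_def field_simps)
  have int: "integrable lborel (I b1)" "integrable lborel (I b2)"
    unfolding I_def using b c by (auto intro: integrable_euler_integrand)
  have h1: "1 / (real m - 1) * hyp2F1 (real m) b1 b2 (- c) = integral\<^sup>L lborel (I b1) / 2"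
    unfolding b(3)[symmetric] hyp2F1_succ_eq_euler_integral[OF b(1) c] using m by (simp add: I_def b1_def)
  have h2: "1 / (real m + 1) * hyp2F1 (real m) b2 (b2 + 1) (- c) = integral\<^sup>L lborel (I b2) / 2"
    unfolding hyp2F1_succ_eq_euler_integral[OF b(2) c] using m by (simp add: I_def b2_def)
  have eq: "indicator {0<..<1} t * (t powr ((real m - 3) / 2) * (1 - t) * (1 / (B + C * t)) ^ m)
     = (1 / B) ^ m * (I b1 t - I b2 t)" for t
  proof (cases "t \<in> {0<..<1}")
    case True
    have D: "0 < 1 + c * t" using True c by (simp add: add_pos_pos)
    have "B + C * t = B * (1 + c * t)" using B by (simp add: c_def field_simps)
    then have "(1 / (B + C * t)) ^ m = (1 / B) ^ m * (1 + c * t) powr (- real m)"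
      using D by (simp add: powr_minus powr_realpow power_divide power_mult_distrib divide_inverse power_inverse)
    moreover have "t powr (b2 - 1) = t powr (b1 - 1) * t"
    proof -
      have "b2 - 1 = (b1 - 1) + 1" using b(3) by simp
      then show ?thesis using True by (simp only: powr_add) simp
    qed
    ultimately show ?thesis
      using True by (simp add: I_def b(5)[symmetric] algebra_simps)
  qed (simp add: I_def)
  have "euler_type_integral m A z
     = (\<integral>\<^sup>+t. ennreal (indicator {0<..<1} t * (t powr ((real m - 3) / 2) * (1 - t) * (1 / (B + C * t)) ^ m)) \<partial>lborel)"
    unfolding euler_type_integral_def B_def C_def
    by (intro nn_integral_cong) (auto split: split_indicator)
  also have "\<dots> = ennreal (LINT t|lborel. (1 / B) ^ m * (I b1 t - I b2 t))"
  proof (subst nn_integral_eq_integral)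
    show "AE t in lborel. 0 \<le> indicator {0<..<1} t * (t powr ((real m - 3) / 2) * (1 - t) * (1 / (B + C * t)) ^ m)"
      using B C by (intro AE_I2) (auto split: split_indicator intro!: mult_nonneg_nonneg add_nonneg_nonneg)
  qed (use int in \<open>simp_all add: eq\<close>)
  also have "(LINT t|lborel. (1 / B) ^ m * (I b1 t - I b2 t)) = (1 / B) ^ m * (integral\<^sup>L lborel (I b1) - integral\<^sup>L lborel (I b2))"
    using int by simp
  also have "\<dots> = 2 * (1 / B) ^ m * (1 / (real m - 1) * hyp2F1 (real m) b1 b2 (- c)
     - 1 / (real m + 1) * hyp2F1 (real m) b2 (b2 + 1) (- c))"
    unfolding h1 h2 by (simp add: algebra_simps)
  finally show ?thesis
    unfolding b(4) unfolding b1_def b2_def c_def .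
qed

section \<open>The spiked Gaussian in orthonormal coordinates\<close>

definition perp :: "real ^ 2 \<Rightarrow> real ^ 2" where
  "perp v = (\<chi> i. if i = 1 then - v $ 2 else v $ 1)"

lemma perp_nth [simp]: "perp v $ 1 = - v $ 2" "perp v $ 2 = v $ 1"
  by (simp_all add: perp_def)

lemma inner_real2: "x \<bullet> y = x $ 1 * y $ 1 + x $ 2 * y $ 2" for x y :: "real ^ 2"
  by (simp add: inner_vec_def sum_2)

lemma norm_1_iff_real2: "norm v = 1 \<longleftrightarrow> v $ 1 * v $ 1 + v $ 2 * v $ 2 = 1" for v :: "real ^ 2"
  by (simp add: norm_eq_1 inner_real2)

lemma Basis_real2: "(Basis :: (real ^ 2) set) = {axis 1 1, axis 2 1}"
  by (auto simp: Basis_vec_def UNIV_2)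

text \<open>The inverse of the coordinate map is the rotation \<open>R\<close>, so the preimage of a
  box is a rotated box, and orthogonal maps preserve volume. The target consists of pairs, not of
  vectors, so that Tonelli applies to it directly.\<close>

lemma distr_orthonormal_coordinates:
  fixes v :: "real ^ 2"
  assumes v: "norm v = 1"
  shows "distr lborel borel (\<lambda>x. (v \<bullet> x, perp v \<bullet> x)) = lborel"
proof (rule lborel_eqI[symmetric])
  let ?T = "\<lambda>x. (v \<bullet> x, perp v \<bullet> x)"
  define R where "R = (\<lambda>y :: real ^ 2. y $ 1 *\<^sub>R v + y $ 2 *\<^sub>R perp v)"
  have v1: "v $ 1 * v $ 1 + v $ 2 * v $ 2 = 1" using v by (simp add: norm_1_iff_real2)
  have [measurable]: "?T \<in> borel \<rightarrow>\<^sub>M borel"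
    by (intro borel_measurable_continuous_onI continuous_intros)
  have "R y \<bullet> R z = y \<bullet> z" for y z
    using v1 unfolding R_def inner_real2 by (simp, algebra)
  then have R: "orthogonal_transformation R"
    unfolding orthogonal_transformation_def R_def by (auto intro!: linearI simp: algebra_simps)
  have TR: "?T (R y) = (y $ 1, y $ 2)" for y
  proof -
    have "v \<bullet> R y = y $ 1" "perp v \<bullet> R y = y $ 2"
      using v1 unfolding R_def inner_real2 by (simp_all, algebra+)
    then show ?thesis by simp
  qed
  have RT: "R (vector [v \<bullet> x, perp v \<bullet> x]) = x" for x
    unfolding vec_eq_iff forall_2 R_def inner_real2 using v1 by (simp, algebra)
  fix l u :: "real \<times> real"
  assume lu: "\<And>b. b \<in> Basis \<Longrightarrow> l \<bullet> b \<le> u \<bullet> b"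
  have le: "fst l \<le> fst u" "snd l \<le> snd u"
    using lu[of "(1, 0)"] lu[of "(0, 1)"] by (cases l; cases u; simp add: Basis_prod_def)+
  let ?B = "box (vector [fst l, snd l]) (vector [fst u, snd u]) :: (real ^ 2) set"
  have mem: "x \<in> box l u \<longleftrightarrow> vector [fst x, snd x] \<in> ?B" for x :: "real \<times> real"
    by (cases l; cases u; cases x) (auto simp: mem_box Basis_prod_def Basis_real2 inner_axis)
  have img: "?T -` box l u = R ` ?B"
  proof (intro equalityI subsetI)
    fix x assume "x \<in> ?T -` box l u"
    then have "vector [v \<bullet> x, perp v \<bullet> x] \<in> ?B"
      by (simp only: vimage_eq mem fst_conv snd_conv)
    then have "R (vector [v \<bullet> x, perp v \<bullet> x]) \<in> R ` ?B"
      by (rule imageI)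
    then show "x \<in> R ` ?B"
      by (simp only: RT)
  next
    fix x assume "x \<in> R ` ?B"
    then obtain y where y: "y \<in> ?B" "x = R y" by blast
    have "vector [y $ 1, y $ 2] = y"
      by (simp add: vec_eq_iff forall_2)
    with y show "x \<in> ?T -` box l u"
      by (simp only: vimage_eq mem TR fst_conv snd_conv)
  qed
  have em: "emeasure lborel S = ennreal (measure lebesgue S)"
    if "S \<in> sets borel" "S \<in> lmeasurable" for S :: "(real ^ 2) set"
    using emeasure_eq_measure2[OF that(2)] that(1) by simp
  have "R ` ?B \<in> sets borel"
    unfolding img[symmetric] by (rule measurable_sets_borel) measurable
  moreover have "R ` ?B \<in> lmeasurable"
    by (intro measurable_orthogonal_image R lmeasurable_box)
  ultimately have "emeasure lborel (R ` ?B) = ennreal (measure lebesgue (R ` ?B))"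
    by (rule em)
  also have "\<dots> = ennreal (measure lebesgue ?B)"
    by (simp only: measure_orthogonal_image[OF R lmeasurable_box])
  also have "\<dots> = emeasure lborel ?B"
    by (rule em[symmetric]) (simp_all only: lmeasurable_box borel_open open_box)
  also have "\<dots> = ennreal (\<Prod>b\<in>Basis. (u - l) \<bullet> b)"
  proof -
    let ?l = "vector [fst l, snd l] :: real ^ 2" and ?u = "vector [fst u, snd u] :: real ^ 2"
    have "(\<Prod>b\<in>Basis. (?u - ?l) \<bullet> b) = (fst u - fst l) * (snd u - snd l)"
      unfolding Basis_real2 by (simp add: axis_eq_axis inner_axis)
    moreover have "(\<Prod>b\<in>Basis. (u - l) \<bullet> b) = (fst u - fst l) * (snd u - snd l)"
      by (cases l; cases u) (simp add: Basis_prod_def)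
    moreover have "?l \<bullet> b \<le> ?u \<bullet> b" if "b \<in> Basis" for b
      using that le unfolding Basis_real2 by (auto simp: inner_axis)
    ultimately show ?thesis
      by (subst emeasure_lborel_box) simp_all
  qed
  finally show "emeasure (distr lborel borel ?T) (box l u) = ennreal (\<Prod>b\<in>Basis. (u - l) \<bullet> b)"
    by (subst emeasure_distr) (simp_all add: img)
qed simp

lemma matrix_inv_eqI:
  fixes A B :: "real ^ 'n ^ 'n"
  assumes AB: "A ** B = mat 1" and BA: "B ** A = mat 1"
  shows "matrix_inv A = B"
proof -
  have "A ** matrix_inv A = mat 1"
    unfolding matrix_inv_def using AB BA by (rule_tac someI2[of _ B]) auto
  then show ?thesis
    by (metis BA matrix_mul_assoc matrix_mul_lid matrix_mul_rid)
qed

text \<open>By the Sherman-Morrison formula the inverse covariance is the identity minus \<beta>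
  times the projection onto \<open>v\<close>, which is diagonal in the rotated basis with entries
  \<open>1 - \<beta> = 1 / (1 + \<theta>)\<close> and 1.\<close>

lemma gaussian_measure_spiked:
  fixes v :: "real ^ 2"
  assumes v: "norm v = 1" and \<theta>: "0 \<le> \<theta>"
  shows "gaussian_measure (mat 1 + \<theta> *\<^sub>R outer v v)
    = density lborel (\<lambda>x. ennreal (gauss_density (1 / (1 + \<theta>)) (v \<bullet> x, perp v \<bullet> x)))"
proof -
  let ?S = "mat 1 + \<theta> *\<^sub>R outer v v"
  define \<beta> where "\<beta> = \<theta> / (1 + \<theta>)"
  have v1: "v $ 1 * v $ 1 + v $ 2 * v $ 2 = 1" using v by (simp add: norm_1_iff_real2)
  have \<beta>: "\<beta> * (1 + \<theta>) = \<theta>" "1 - \<beta> = 1 / (1 + \<theta>)" using \<theta> by (simp_all add: \<beta>_def field_simps)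
  have inv: "matrix_inv ?S = mat 1 - \<beta> *\<^sub>R outer v v"
  proof (rule matrix_inv_eqI)
    show "?S ** (mat 1 - \<beta> *\<^sub>R outer v v) = mat 1"
      unfolding vec_eq_iff forall_2 using v1 \<beta>(1)
      by (simp add: matrix_matrix_mult_def sum_2 mat_def outer_def, intro conjI) algebra+
    show "(mat 1 - \<beta> *\<^sub>R outer v v) ** ?S = mat 1"
      unfolding vec_eq_iff forall_2 using v1 \<beta>(1)
      by (simp add: matrix_matrix_mult_def sum_2 mat_def outer_def, intro conjI) algebra+
  qed
  have det: "det ?S = 1 + \<theta>"
    using v1 by (simp add: det_2 mat_def outer_def) algebra
  have quad: "x \<bullet> (matrix_inv ?S *v x) = 1 / (1 + \<theta>) * (v \<bullet> x)\<^sup>2 + (perp v \<bullet> x)\<^sup>2" for x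
    unfolding inv \<beta>(2)[symmetric] using v1
    by (simp add: inner_real2 matrix_vector_mult_def sum_2 mat_def outer_def power2_eq_square) algebra
  have "exp (- (x \<bullet> (matrix_inv ?S *v x)) / 2) / sqrt ((2 * pi) ^ CARD(2) * det ?S)
    = gauss_density (1 / (1 + \<theta>)) (v \<bullet> x, perp v \<bullet> x)" for x
    unfolding quad det gauss_density_def using \<theta>
    by (simp add: real_sqrt_mult real_sqrt_divide)
  then show ?thesis
    unfolding gaussian_measure_def by presburger
qed

lemma nn_integral_gauss_density:
  assumes A: "0 < A"
  shows "(\<integral>\<^sup>+u. ennreal (gauss_density A u) \<partial>lborel) = 1"
proof -
  have "(\<integral>\<^sup>+u. ennreal (gauss_density A u) \<partial>lborel)
    = (\<integral>\<^sup>+p. \<integral>\<^sup>+q. ennreal (sqrt A / (2 * pi)) * ennreal (exp (- (A * p\<^sup>2 - 2 * 0 * p * q + 1 * q\<^sup>2) / 2)) \<partial>lborel \<partial>lborel)"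
    using A by (subst nn_integral_lborel_pair, measurable)
      (auto simp: gauss_density_def ennreal_mult'[symmetric] intro!: nn_integral_cong)
  also have "\<dots> = ennreal (sqrt A / (2 * pi)) *
      (\<integral>\<^sup>+p. \<integral>\<^sup>+q. ennreal (exp (- (A * p\<^sup>2 - 2 * 0 * p * q + 1 * q\<^sup>2) / 2)) \<partial>lborel \<partial>lborel)"
    by (subst nn_integral_cmult[symmetric], measurable, subst nn_integral_cmult[symmetric], measurable)
  also have "(\<integral>\<^sup>+p. \<integral>\<^sup>+q. ennreal (exp (- (A * p\<^sup>2 - 2 * 0 * p * q + 1 * q\<^sup>2) / 2)) \<partial>lborel \<partial>lborel)
    = ennreal (pi / sqrt (1 * A - 0\<^sup>2)) * (\<integral>\<^sup>+x\<in>{0<..}. ennreal (exp (- x / 2)) \<partial>lborel)"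
    using A by (intro nn_integral_quadratic_form[where F = "\<lambda>x. ennreal (exp (- x / 2))"]) auto
  also have "(\<integral>\<^sup>+x\<in>{0<..}. ennreal (exp (- x / 2)) \<partial>lborel) = ennreal 2"
    using nn_integral_power_times_exp_scaled[of 1 0] by simp
  also have "ennreal (sqrt A / (2 * pi)) * (ennreal (pi / sqrt (1 * A - 0\<^sup>2)) * ennreal 2) = 1"
    using A by (subst ennreal_mult'[symmetric], simp, subst ennreal_mult'[symmetric]) simp_all
  finally show ?thesis .
qed

section \<open>Wishart matrices and their eigenvectors\<close>

text \<open>One off-diagonal entry is enough for Gram matrices; the type itself does not force
  symmetry.\<close>

definition coord_triple :: "real ^ 2 \<Rightarrow> real ^ 2 ^ 2 \<Rightarrow> real \<times> real \<times> real" where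
  "coord_triple v G = (v \<bullet> (G *v v), v \<bullet> (G *v perp v), perp v \<bullet> (G *v perp v))"

lemma coord_triple_measurable [measurable]: "coord_triple v \<in> borel_measurable borel"
  unfolding coord_triple_def[abs_def] inner_real2 matrix_vector_mult_def sum_2 vec_lambda_beta
  by (intro borel_measurable_continuous_onI continuous_intros)

lemma sum_sq_map: "(\<Sum>j\<in>J. sq_map (f j)) = (\<Sum>j\<in>J. (fst (f j))\<^sup>2, \<Sum>j\<in>J. fst (f j) * snd (f j), \<Sum>j\<in>J. (snd (f j))\<^sup>2)"
  by (induction J rule: infinite_finite_induct) (auto simp: sq_map_def zero_prod_def)

lemma inner_gram: "x \<bullet> (gram m X *v y) = (\<Sum>j<m. (x \<bullet> X j) * (y \<bullet> X j))" for x y :: "real ^ 2"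
  unfolding gram_def inner_real2 matrix_vector_mult_def sum_2 vec_lambda_beta
  by (simp add: sum_distrib_left sum_distrib_right sum.distrib[symmetric]) (simp add: algebra_simps)

lemma coord_triple_gram: "coord_triple v (gram m X) = (\<Sum>j<m. sq_map (v \<bullet> X j, perp v \<bullet> X j))"
  by (simp add: coord_triple_def inner_gram sum_sq_map power2_eq_square)

lemma gram_measurable:
  fixes N :: "(real ^ 2) measure"
  assumes [measurable_cong]: "sets N = sets borel"
  shows "gram m \<in> borel_measurable (\<Pi>\<^sub>M j\<in>{..<m}. N)"
proof -
  have nth [measurable]: "(\<lambda>x :: real ^ 2. x $ i) \<in> borel_measurable borel" for i
    by (intro borel_measurable_continuous_onI continuous_intros)
  have "(\<lambda>X. gram m X $ i $ k) \<in> borel_measurable (\<Pi>\<^sub>M j\<in>{..<m}. N)" for i k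
    unfolding gram_def vec_lambda_beta by measurable
  then show ?thesis
    by (subst borel_measurable_euclidean_space) (auto simp: Basis_vec_def inner_axis)
qed

lemma nn_integral_wishart_spiked:
  fixes v :: "real ^ 2" and F :: "real \<times> real \<times> real \<Rightarrow> ennreal"
  assumes v: "norm v = 1" and \<theta>: "0 \<le> \<theta>" and m: "2 \<le> m" and [measurable]: "F \<in> borel_measurable borel"
  shows "(\<integral>\<^sup>+G. F (coord_triple v G) \<partial>wishart m (mat 1 + \<theta> *\<^sub>R outer v v))
    = (\<integral>\<^sup>+w. F w * ennreal (wishart_density m (1 / (1 + \<theta>)) w) \<partial>lborel)"
proof -
  define N where "N = gaussian_measure (mat 1 + \<theta> *\<^sub>R outer v v)"
  define T where "T = (\<lambda>x. (v \<bullet> x, perp v \<bullet> x))"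
  define A where "A = 1 / (1 + \<theta>)"
  have A: "0 < A" using \<theta> by (simp add: A_def)
  have sN [measurable_cong]: "sets N = sets borel"
    by (simp add: N_def gaussian_measure_def)
  have [measurable]: "T \<in> borel \<rightarrow>\<^sub>M borel"
    unfolding T_def by (intro borel_measurable_continuous_onI continuous_intros)
  have dT: "distr N borel T = density lborel (\<lambda>u. ennreal (gauss_density A u))"
    using density_distr[of "\<lambda>u. ennreal (gauss_density A u)" borel T lborel]
      distr_orthonormal_coordinates[OF v] gaussian_measure_spiked[OF v \<theta>]
    by (simp add: N_def A_def T_def)
  have "emeasure N (space N) = emeasure (distr N borel T) UNIV"
    by (subst emeasure_distr) simp_all
  also have "\<dots> = 1"
    unfolding dT by (subst emeasure_density) (simp_all add: nn_integral_gauss_density A)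
  finally have "prob_space N"
    by (rule prob_spaceI)
  have [measurable]: "gram m \<in> borel_measurable (\<Pi>\<^sub>M j\<in>{..<m}. N)"
    by (rule gram_measurable[OF sN])
  have "(\<integral>\<^sup>+G. F (coord_triple v G) \<partial>wishart m (mat 1 + \<theta> *\<^sub>R outer v v))
     = (\<integral>\<^sup>+X. F (\<Sum>j<m. sq_map (T (X j))) \<partial>(\<Pi>\<^sub>M j\<in>{..<m}. N))"
    unfolding wishart_def N_def[symmetric] T_def coord_triple_gram[symmetric]
    by (rule nn_integral_distr) measurable
  also have "\<dots> = (\<integral>\<^sup>+w. F w * ennreal (wishart_density m A w) \<partial>lborel)"
    by (rule nn_integral_wishart_density) (fact | simp)+
  finally show ?thesis unfolding A_def .
qed

text \<open>The entry triple has a density with respect to \<open>lborel\<close>, for which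
  \<open>b = 0\<close> is a null set; symmetry holds for every Gram matrix. Nonzero \<open>b\<close>
  excludes equal eigenvalues, and with them the meaningless values of
  \<open>angle_of\<close>.\<close>

lemma AE_wishart_spiked:
  fixes v :: "real ^ 2"
  assumes v: "norm v = 1" and \<theta>: "0 \<le> \<theta>" and m: "2 \<le> m"
  shows "AE G in wishart m (mat 1 + \<theta> *\<^sub>R outer v v). v \<bullet> (G *v perp v) \<noteq> 0 \<and> perp v \<bullet> (G *v v) = v \<bullet> (G *v perp v)"
proof -
  let ?S = "mat 1 + \<theta> *\<^sub>R outer v v"
  define N where "N = gaussian_measure ?S"
  have sN: "sets N = sets borel"
    by (simp add: N_def gaussian_measure_def)
  have [measurable]: "(\<lambda>G :: real ^ 2 ^ 2. v \<bullet> (G *v perp v)) \<in> borel_measurable borel"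
    "(\<lambda>G :: real ^ 2 ^ 2. perp v \<bullet> (G *v v)) \<in> borel_measurable borel"
    unfolding inner_real2 matrix_vector_mult_def sum_2 vec_lambda_beta
    by (intro borel_measurable_continuous_onI continuous_intros)+
  have sW [measurable_cong]: "sets (wishart m ?S) = sets borel"
    by (simp add: wishart_def)
  have [measurable]: "(\<lambda>w :: real \<times> real \<times> real. indicator {0} (fst (snd w)) :: ennreal) \<in> borel_measurable borel"
    unfolding borel_prod[symmetric] by measurable
  define g where "g = (\<lambda>w. indicator {0} (fst (snd w)) * ennreal (wishart_density m (1 / (1 + \<theta>)) w))"
  have [measurable]: "g \<in> borel_measurable borel"
    unfolding g_def by measurable
  have "(\<integral>\<^sup>+G. indicator {0} (v \<bullet> (G *v perp v)) \<partial>wishart m ?S)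
     = (\<integral>\<^sup>+G. (\<lambda>w. indicator {0} (fst (snd w))) (coord_triple v G) \<partial>wishart m ?S)"
    by (simp add: coord_triple_def)
  also have "\<dots> = (\<integral>\<^sup>+w. g w \<partial>lborel)"
    unfolding g_def by (rule nn_integral_wishart_spiked[OF v \<theta> m]) measurable
  also have "\<dots> = (\<integral>\<^sup>+a. \<integral>\<^sup>+b. \<integral>\<^sup>+c. g (a, b, c) \<partial>lborel \<partial>lborel \<partial>lborel)"
    by (subst nn_integral_lborel_pair, measurable, subst nn_integral_lborel_pair, measurable)
  also have "\<dots> = (\<integral>\<^sup>+a. \<integral>\<^sup>+b. 0 \<partial>(lborel :: real measure) \<partial>(lborel :: real measure))"
    by (rule nn_integral_cong, rule nn_integral_cong_AE, use AE_lborel_singleton[of 0] in eventually_elim) (simp add: g_def)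
  finally have "(\<integral>\<^sup>+G. indicator {0} (v \<bullet> (G *v perp v)) \<partial>wishart m ?S) = 0"
    by simp
  then have 1: "AE G in wishart m ?S. v \<bullet> (G *v perp v) \<noteq> 0"
    by (subst (asm) nn_integral_0_iff_AE, measurable) (auto simp: indicator_eq_0_iff elim: eventually_mono)
  have "AE G in wishart m ?S. perp v \<bullet> (G *v v) = v \<bullet> (G *v perp v)"
    unfolding wishart_def N_def[symmetric]
    by (subst AE_distr_iff[OF gram_measurable[OF sN]]) (measurable, simp add: inner_gram mult.commute)
  with 1 show ?thesis by eventually_elim simp
qed

text \<open>The first eigenvalue equation fixes the ratio of the two coordinates of
  \<open>x\<close>. Squared and combined with unit length it determines
  \<open>(v \<bullet> x)^2\<close> from the eigenvalue alone, regardless of the sign of the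
  eigenvector.\<close>

lemma eigenvector_angle:
  fixes v :: "real ^ 2" and G :: "real ^ 2 ^ 2"
  assumes v: "norm v = 1" and b0: "v \<bullet> (G *v perp v) \<noteq> 0"
    and sym: "perp v \<bullet> (G *v v) = v \<bullet> (G *v perp v)"
  shows "unit_eigenvector G (Min (eigenvalues G)) x \<Longrightarrow> \<bar>v \<bullet> x\<bar>\<^sup>2 = angle_of (coord_triple v G)"
    and "unit_eigenvector G (Max (eigenvalues G)) x \<Longrightarrow> \<bar>v \<bullet> x\<bar>\<^sup>2 = 1 - angle_of (coord_triple v G)"
proof -
  define w where "w = perp v"
  define a b c where "a = v \<bullet> (G *v v)" and "b = v \<bullet> (G *v w)" and "c = w \<bullet> (G *v w)"
  define D where "D = sqrt ((a - c)\<^sup>2 + 4 * b\<^sup>2)"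
  define l1 l2 where "l1 = (a + c - D) / 2" and "l2 = (a + c + D) / 2"
  have v1: "v $ 1 * v $ 1 + v $ 2 * v $ 2 = 1" using v by (simp add: norm_1_iff_real2)
  have b: "b \<noteq> 0" "w \<bullet> (G *v v) = b" using b0 sym by (auto simp: b_def w_def)
  have D2: "D\<^sup>2 = (a - c)\<^sup>2 + 4 * b\<^sup>2" by (simp add: D_def)
  have "sqrt ((a - c)\<^sup>2) < D"
    unfolding D_def using b by (intro real_sqrt_less_mono) simp
  then have D: "\<bar>a - c\<bar> < D" by simp
  have ang: "angle_of (coord_triple v G) = (D - (a - c)) / (2 * D)"
  proof -
    have "angle_of (coord_triple v G) = (1 - (a - c) / D) / 2"
      by (simp add: angle_of_def coord_triple_def a_def b_def c_def w_def D_def)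
    also have "\<dots> = (D - (a - c)) / (2 * D)"
      using D by (simp add: field_simps)
    finally show ?thesis .
  qed
  have dec: "y = (v \<bullet> y) *\<^sub>R v + (w \<bullet> y) *\<^sub>R w" for y
    unfolding vec_eq_iff forall_2 inner_real2 w_def using v1 by (simp, algebra)
  have on: "v \<bullet> v = 1" "w \<bullet> w = 1" "v \<bullet> w = 0" "w \<bullet> v = 0"
    using v1 by (auto simp: inner_real2 w_def)
  have eqI: "y = z" if "v \<bullet> y = v \<bullet> z" "w \<bullet> y = w \<bullet> z" for y z
    using dec[of y] dec[of z] that by simp
  have Gv: "v \<bullet> (G *v y) = a * (v \<bullet> y) + b * (w \<bullet> y)" and Gw: "w \<bullet> (G *v y) = b * (v \<bullet> y) + c * (w \<bullet> y)" for y
  proof -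
    have "G *v y = (v \<bullet> y) *\<^sub>R (G *v v) + (w \<bullet> y) *\<^sub>R (G *v w)"
      by (subst dec[of y]) (simp add: matrix_vector_right_distrib matrix_vector_mult_scaleR)
    then show "v \<bullet> (G *v y) = a * (v \<bullet> y) + b * (w \<bullet> y)" "w \<bullet> (G *v y) = b * (v \<bullet> y) + c * (w \<bullet> y)"
      by (simp_all add: inner_add_right a_def b_def[symmetric] c_def b(2) mult.commute)
  qed
  have eig: "G *v y = \<mu> *\<^sub>R y \<longleftrightarrow> (\<mu> - a) * (v \<bullet> y) = b * (w \<bullet> y) \<and> (\<mu> - c) * (w \<bullet> y) = b * (v \<bullet> y)" for y \<mu>
  proof -
    have "G *v y = \<mu> *\<^sub>R y \<longleftrightarrow> v \<bullet> (G *v y) = v \<bullet> (\<mu> *\<^sub>R y) \<and> w \<bullet> (G *v y) = w \<bullet> (\<mu> *\<^sub>R y)"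
      using eqI by auto
    then show ?thesis
      unfolding Gv Gw by (auto simp: algebra_simps)
  qed
  have char: "(\<mu> - a) * (\<mu> - c) = b\<^sup>2 \<longleftrightarrow> \<mu> = l1 \<or> \<mu> = l2" for \<mu>
  proof -
    have "4 * ((\<mu> - a) * (\<mu> - c) - b\<^sup>2) = (2 * \<mu> - (a + c))\<^sup>2 - D\<^sup>2"
      unfolding D2 by algebra
    also have "\<dots> = 4 * ((\<mu> - l1) * (\<mu> - l2))"
      unfolding l1_def l2_def by (simp add: field_simps power2_eq_square)
    finally show ?thesis by auto
  qed
  have ev: "eigenvalues G = {l1, l2}"
  proof (intro equalityI subsetI)
    fix \<mu> assume "\<mu> \<in> eigenvalues G"
    then obtain y where y: "y \<noteq> 0" "(\<mu> - a) * (v \<bullet> y) = b * (w \<bullet> y)" "(\<mu> - c) * (w \<bullet> y) = b * (v \<bullet> y)"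
      unfolding eigenvalues_def eig by blast
    have "v \<bullet> y \<noteq> 0"
    proof
      assume 0: "v \<bullet> y = 0"
      with y b have "w \<bullet> y = 0" by simp
      with 0 y(1) dec[of y] show False by simp
    qed
    moreover have "((\<mu> - a) * (\<mu> - c)) * (v \<bullet> y) = b\<^sup>2 * (v \<bullet> y)"
      using y(2,3) by algebra
    ultimately show "\<mu> \<in> {l1, l2}" using char[of \<mu>] by simp
  next
    fix \<mu> assume "\<mu> \<in> {l1, l2}"
    then have ch: "(\<mu> - a) * (\<mu> - c) = b\<^sup>2" using char by auto
    \<comment> \<open>This vector solves the first eigenvalue equation by construction and the
      second by the characteristic equation; it is nonzero because \<open>b\<close> is.\<close>
    define y where "y = b *\<^sub>R v + (\<mu> - a) *\<^sub>R w"
    have y: "v \<bullet> y = b" "w \<bullet> y = \<mu> - a" by (simp_all add: y_def inner_add_right on)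
    have "y \<noteq> 0" using y b by auto
    moreover have "G *v y = \<mu> *\<^sub>R y"
      unfolding eig y using ch by (simp add: power2_eq_square mult.commute)
    ultimately show "\<mu> \<in> eigenvalues G" unfolding eigenvalues_def by blast
  qed
  have l: "l1 \<le> l2" using D by (simp add: l1_def l2_def)
  have sq: "(v \<bullet> x)\<^sup>2 * ((\<mu> - a)\<^sup>2 + b\<^sup>2) = b\<^sup>2" if "unit_eigenvector G \<mu> x" for \<mu>
  proof -
    have e: "(\<mu> - a) * (v \<bullet> x) = b * (w \<bullet> x)" "x \<bullet> x = 1"
      using that unfolding unit_eigenvector_def eig by (auto simp: norm_eq_1)
    have "x \<bullet> x = (v \<bullet> x)\<^sup>2 + (w \<bullet> x)\<^sup>2"
      by (subst (1 2) dec[of x]) (simp add: inner_add_left inner_add_right on power2_eq_square)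
    with e show ?thesis by algebra
  qed
  have q1: "(l1 - a)\<^sup>2 + b\<^sup>2 = D * (D + (a - c)) / 2"
    using D2 unfolding l1_def by (simp add: field_simps power2_eq_square)
  have q2: "(l2 - a)\<^sup>2 + b\<^sup>2 = D * (D - (a - c)) / 2"
    using D2 unfolding l2_def by (simp add: field_simps power2_eq_square)
  \<comment> \<open>In this factored form \<open>b^2\<close> shares a factor
    \<open>D + (a - c)\<close> or \<open>D - (a - c)\<close> with the norms above. Both are positive
    since \<open>\<bar>a - c\<bar> < D\<close>, so they cancel.\<close>
  have bb: "b\<^sup>2 = (D - (a - c)) * (D + (a - c)) / 4"
    using D2 by (simp add: field_simps power2_eq_square)
  show "\<bar>v \<bullet> x\<bar>\<^sup>2 = angle_of (coord_triple v G)" if "unit_eigenvector G (Min (eigenvalues G)) x"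
  proof -
    have "unit_eigenvector G l1 x" using that l by (simp add: ev min_def)
    from sq[OF this] have "(D + (a - c)) * ((v \<bullet> x)\<^sup>2 * (2 * D)) = (D + (a - c)) * (D - (a - c))"
      unfolding q1 unfolding bb by (simp add: field_simps)
    then have "(v \<bullet> x)\<^sup>2 * (2 * D) = D - (a - c)"
      using D by (subst (asm) mult_cancel_left) auto
    then show ?thesis
      unfolding ang using D by (simp add: eq_divide_eq)
  qed
  show "\<bar>v \<bullet> x\<bar>\<^sup>2 = 1 - angle_of (coord_triple v G)" if "unit_eigenvector G (Max (eigenvalues G)) x"
  proof -
    have "unit_eigenvector G l2 x" using that l by (simp add: ev max_def)
    from sq[OF this] have "(D - (a - c)) * ((v \<bullet> x)\<^sup>2 * (2 * D)) = (D - (a - c)) * (D + (a - c))"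
      unfolding q2 unfolding bb by (simp add: field_simps)
    then have "(v \<bullet> x)\<^sup>2 * (2 * D) = D + (a - c)"
      using D by (subst (asm) mult_cancel_left) auto
    then have "(v \<bullet> x)\<^sup>2 = (D + (a - c)) / (2 * D)"
      using D by (simp add: eq_divide_eq)
    moreover have "1 - (D - (a - c)) / (2 * D) = (D + (a - c)) / (2 * D)"
      using D by (simp add: field_simps)
    ultimately show ?thesis
      unfolding ang by simp
  qed
qed

text \<open>The map \<phi> lets one computation serve both eigenvectors: it is the identity for the
  smallest eigenvalue and \<open>1 - z\<close> for the largest, as the squared coordinates of
  \<open>v\<close> in the eigenbasis add up to 1.\<close>

lemma distr_angle_wishart_spiked:
  fixes v :: "real ^ 2"
  assumes v: "norm v = 1" and \<theta>: "0 \<le> \<theta>" and m: "2 \<le> m" and [measurable]: "\<phi> \<in> borel_measurable borel"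
  shows "distr (wishart m (mat 1 + \<theta> *\<^sub>R outer v v)) lborel (\<lambda>G. \<phi> (angle_of (coord_triple v G)))
    = distr (density lborel (\<lambda>z. ennreal (2 ^ m * (real m - 1) * (1 / (1 + \<theta>)) powr (real m / 2) / (4 * pi) / sqrt (z * (1 - z)))
        * euler_type_integral m (1 / (1 + \<theta>)) z * indicator {0<..<1} z)) lborel \<phi>" (is "?L = distr (density lborel ?d) lborel \<phi>")
proof (rule measure_eqI)
  let ?S = "mat 1 + \<theta> *\<^sub>R outer v v"
  have [measurable_cong]: "sets (wishart m ?S) = sets borel"
    by (simp add: wishart_def)
  fix X assume "X \<in> sets ?L"
  then have [measurable]: "X \<in> sets borel" by simp
  have "emeasure ?L X = (\<integral>\<^sup>+G. indicator X (\<phi> (angle_of (coord_triple v G))) \<partial>wishart m ?S)"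
    by (subst nn_integral_indicator[symmetric], simp, subst nn_integral_distr) simp_all
  also have "\<dots> = (\<integral>\<^sup>+w. indicator X (\<phi> (angle_of w)) * ennreal (wishart_density m (1 / (1 + \<theta>)) w) \<partial>lborel)"
    by (rule nn_integral_wishart_spiked[OF v \<theta> m]) measurable
  also have "\<dots> = (\<integral>\<^sup>+z. indicator X (\<phi> z) * ?d z \<partial>lborel)"
    using \<theta> by (subst nn_integral_wishart_density_angle[where h = "\<lambda>z. indicator X (\<phi> z)"]) (simp_all add: m mult.assoc)
  also have "\<dots> = emeasure (distr (density lborel ?d) lborel \<phi>) X"
    by (subst nn_integral_indicator[symmetric], simp, subst nn_integral_distr, simp, simp, subst nn_integral_density)
      (simp_all add: mult.commute)
  finally show "emeasure ?L X = emeasure (distr (density lborel ?d) lborel \<phi>) X" .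
qed simp

lemma distr_density_reflect:
  fixes d :: "real \<Rightarrow> ennreal"
  assumes [measurable]: "d \<in> borel_measurable borel"
  shows "distr (density lborel d) lborel (\<lambda>z. 1 - z) = density lborel (\<lambda>z. d (1 - z))"
proof (rule measure_eqI)
  fix X assume "X \<in> sets (distr (density lborel d) lborel (\<lambda>z. 1 - z))"
  then have [measurable]: "X \<in> sets borel" by simp
  have "emeasure (distr (density lborel d) lborel (\<lambda>z. 1 - z)) X = (\<integral>\<^sup>+z. d z * indicator X (1 - z) \<partial>lborel)"
    by (subst nn_integral_indicator[symmetric], simp, subst nn_integral_distr, simp, simp, subst nn_integral_density) simp_all
  also have "\<dots> = emeasure (density lborel (\<lambda>z. d (1 - z))) X"
    by (subst nn_integral_real_affine[where c = "-1" and t = 1]) (simp_all add: emeasure_density)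
  finally show "emeasure (distr (density lborel d) lborel (\<lambda>z. 1 - z)) X = emeasure (density lborel (\<lambda>z. d (1 - z))) X" .
qed simp

theorem mainTheorem7:
  fixes m :: nat
    and \<theta> \<beta> :: real
    and v :: "real ^ 2"
    and M :: "'a measure"
    and W :: "'a \<Rightarrow> real ^ 2 ^ 2"
    and o1 o2 :: "'a \<Rightarrow> real ^ 2"
    and f :: "real \<Rightarrow> real"
  assumes "m \<ge> 2"
    and "\<theta> \<ge> 0"
    and "\<beta> = \<theta> / (1 + \<theta>)"
    and "norm v = 1"
    and "prob_space M"
    and "W \<in> M \<rightarrow>\<^sub>M borel"
    and "distr M borel W = wishart m (mat 1 + \<theta> *\<^sub>R outer v v)"
    and "AE \<omega> in M. unit_eigenvector (W \<omega>) (Min (eigenvalues (W \<omega>))) (o1 \<omega>)"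
    and "AE \<omega> in M. unit_eigenvector (W \<omega>) (Max (eigenvalues (W \<omega>))) (o2 \<omega>)"
    and "(\<lambda>\<omega>. \<bar>v \<bullet> o1 \<omega>\<bar>\<^sup>2) \<in> borel_measurable M"
    and "(\<lambda>\<omega>. \<bar>v \<bullet> o2 \<omega>\<bar>\<^sup>2) \<in> borel_measurable M"
    and "\<And>z. f z =
      2 ^ (m - 1) * (real m - 1) / (pi * (1 + \<theta>) powr (real m / 2))
      * z powr (- 1 / 2) * (1 - z) powr (- 1 / 2) * (1 - \<beta> * (1 - z)) powr (- real m)
      * (1 / (real m - 1)
           * hyp2F1 (real m) ((real m - 1) / 2) ((real m + 1) / 2)
               (- ((1 - \<beta> * z) / (1 - \<beta> * (1 - z))))
         - 1 / (real m + 1)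
           * hyp2F1 (real m) ((real m + 1) / 2) ((real m + 3) / 2)
               (- ((1 - \<beta> * z) / (1 - \<beta> * (1 - z)))))"
  shows "distributed M lborel (\<lambda>\<omega>. \<bar>v \<bullet> o1 \<omega>\<bar>\<^sup>2)
           (\<lambda>z. ennreal (f z * indicator {0<..<1} z)) \<and>
         distributed M lborel (\<lambda>\<omega>. \<bar>v \<bullet> o2 \<omega>\<bar>\<^sup>2)
           (\<lambda>z. ennreal (f (1 - z) * indicator {0<..<1} z))"
proof -
  note m = assms(1) and \<theta> = assms(2) and \<beta> = assms(3) and v = assms(4) and law = assms(7) and f = assms(12)
  note [measurable] = assms(6,10,11)
  let ?S = "mat 1 + \<theta> *\<^sub>R outer v v"
  define A where "A = 1 / (1 + \<theta>)"
  have A: "0 < A" using \<theta> by (simp add: A_def)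
  define d where "d = (\<lambda>z. ennreal (2 ^ m * (real m - 1) * A powr (real m / 2) / (4 * pi) / sqrt (z * (1 - z)))
        * euler_type_integral m A z * indicator {0<..<1} z)"
  have [measurable]: "d \<in> borel_measurable borel"
    unfolding d_def by measurable
  have d: "d z = ennreal (f z * indicator {0<..<1} z)" for z
  proof (cases "z \<in> {0<..<1}")
    case True
    then have z: "0 < z" "z < 1" by auto
    define B where "B = z + A * (1 - z)"
    define C where "C = 1 - z + A * z"
    define H where "H = 1 / (real m - 1) * hyp2F1 (real m) ((real m - 1) / 2) ((real m + 1) / 2) (- (C / B))
         - 1 / (real m + 1) * hyp2F1 (real m) ((real m + 1) / 2) ((real m + 3) / 2) (- (C / B))"
    have B: "0 < B" unfolding B_def using A z by (intro add_pos_pos mult_pos_pos) auto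
    have \<beta>A: "\<beta> = 1 - A" using \<theta> by (simp add: \<beta> A_def field_simps)
    have BC: "1 - \<beta> * (1 - z) = B" "1 - \<beta> * z = C"
      unfolding B_def C_def \<beta>A by algebra+
    have p1: "B powr (- real m) = (1 / B) ^ m"
      using B by (simp add: powr_minus powr_realpow power_divide inverse_eq_divide)
    have p2: "z powr (- 1 / 2) * (1 - z) powr (- 1 / 2) = 1 / sqrt (z * (1 - z))"
    proof -
      have e: "- 1 / 2 = - (1 / 2 :: real)" by simp
      show ?thesis
        unfolding e powr_minus using z by (simp add: powr_half_sqrt real_sqrt_mult inverse_eq_divide)
    qed
    have p3: "A powr (real m / 2) = 1 / (1 + \<theta>) powr (real m / 2)"
      unfolding A_def using \<theta> by (simp add: powr_divide)
    have p4: "(2::real) ^ m = 2 * 2 ^ (m - 1)"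
      using m by (cases m) simp_all
    \<comment> \<open>The 2 from the Euler integrals and \<open>2 ^ m / (4 * pi)\<close> combine to
      the stated \<open>2 ^ (m - 1) / pi\<close>.\<close>
    have fz: "f z = 2 ^ m * (real m - 1) * A powr (real m / 2) / (4 * pi) / sqrt (z * (1 - z)) * (2 * (1 / B) ^ m * H)"
    proof -
      have "f z = 2 ^ (m - 1) * (real m - 1) / (pi * (1 + \<theta>) powr (real m / 2)) * (z powr (- 1 / 2) * (1 - z) powr (- 1 / 2)) * B powr (- real m) * H"
        unfolding f BC H_def by (simp only: mult.assoc)
      then show ?thesis
        unfolding p1 p2 p3 p4 by (simp add: mult_ac)
    qed
    have "d z = ennreal (2 ^ m * (real m - 1) * A powr (real m / 2) / (4 * pi) / sqrt (z * (1 - z))) * ennreal (2 * (1 / B) ^ m * H)"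
      using True by (simp add: d_def B_def C_def H_def euler_type_integral_eq_hyp2F1[OF m A z])
    also have "\<dots> = ennreal (f z)"
      unfolding fz using m z by (intro ennreal_mult'[symmetric]) auto
    finally show ?thesis using True by simp
  qed (simp add: d_def)
  have AE1: "AE \<omega> in M. v \<bullet> (W \<omega> *v perp v) \<noteq> 0 \<and> perp v \<bullet> (W \<omega> *v v) = v \<bullet> (W \<omega> *v perp v)"
    using AE_wishart_spiked[OF v \<theta> m] unfolding law[symmetric] by (rule AE_distrD[rotated]) measurable
  have o1: "AE \<omega> in M. \<bar>v \<bullet> o1 \<omega>\<bar>\<^sup>2 = angle_of (coord_triple v (W \<omega>))"
    using AE1 assms(8) by eventually_elim (use eigenvector_angle(1)[OF v] in blast)
  have o2: "AE \<omega> in M. \<bar>v \<bullet> o2 \<omega>\<bar>\<^sup>2 = 1 - angle_of (coord_triple v (W \<omega>))"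
    using AE1 assms(9) by eventually_elim (use eigenvector_angle(2)[OF v] in blast)
  \<comment> \<open>The eigenvectors are arbitrary choices, so only the almost sure value of the
    squared projection links them to \<open>W\<close>; measurability is assumed for that projection,
    not for the eigenvector.\<close>
  have distr: "distr M lborel X = distr (density lborel d) lborel \<phi>"
    if X: "X \<in> borel_measurable M" "AE \<omega> in M. X \<omega> = \<phi> (angle_of (coord_triple v (W \<omega>)))"
      and [measurable]: "\<phi> \<in> borel_measurable borel" for X \<phi>
  proof -
    have "distr M lborel X = distr M lborel (\<lambda>\<omega>. \<phi> (angle_of (coord_triple v (W \<omega>))))"
      using X by (intro distr_cong_AE) auto
    also have "\<dots> = distr (wishart m ?S) lborel (\<lambda>G. \<phi> (angle_of (coord_triple v G)))"
      unfolding law[symmetric] by (subst distr_distr) (auto simp: comp_def)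
    also have "\<dots> = distr (density lborel d) lborel \<phi>"
      unfolding d_def A_def by (rule distr_angle_wishart_spiked[OF v \<theta> m]) fact
    finally show ?thesis .
  qed
  have "distr M lborel (\<lambda>\<omega>. \<bar>v \<bullet> o1 \<omega>\<bar>\<^sup>2) = density lborel d"
    using distr[OF assms(10), of "\<lambda>z. z"] o1 distr_id2[of lborel "density lborel d"] by simp
  moreover have "distr M lborel (\<lambda>\<omega>. \<bar>v \<bullet> o2 \<omega>\<bar>\<^sup>2) = density lborel (\<lambda>z. d (1 - z))"
    using distr[OF assms(11), of "\<lambda>z. 1 - z"] o2 distr_density_reflect[of d] by simp
  moreover have "(\<lambda>z. ennreal (f z * indicator {0<..<1} z)) = d"
    by (auto simp: d)
  moreover have "(\<lambda>z. ennreal (f (1 - z) * indicator {0<..<1} z)) = (\<lambda>z. d (1 - z))"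
    by (auto simp: d split: split_indicator)
  ultimately show ?thesis
    using assms(10,11) by (simp add: distributed_def)
qed

end
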